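(* If $n,r$ are positive integers with $1\le r\le\log n$, then $$\nu(n,r)=\frac1{\sqrt{2\pi nr}}\exp\left\{-\frac{n\log n}{r}+\frac nr+\sum_{k=1}^r d_{rk}\,n^{(r-k)/r}\right\}\left(1+O\left(n^{-1/r}\right)\right),$$ where $$d_{rr}=-\frac1r\sum_{j=2}^r\frac1j$$ and $$d_{rk}=\frac{\Gamma(k+k/r)}{(r-k)\,\Gamma(k+1)\,\Gamma(1+k/r)}\qquad\text{if } 1\le k\le r-1.$$
   Context: $S_n$ is the symmetric group on $n$ symbols and $k_j(\sigma)$ is the number of cycles of length $j$ in $\sigma\in S_n$. For $1\le r\le n$, $$\nu(n,r)=\frac1{n!}\left|\{\sigma\in S_n:\ k_j(\sigma)=0 \text{ for all } r+1\le j\le n\}\right|.$$ The implied constant in $O(\cdot)$ is absolute (uniform over all $n,r$ in the stated range). $\log$ is the natural logarithm; $\Gamma$ is the Gamma function. *)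

theory Defs
  imports "HOL-Analysis.Analysis" "HOL-Combinatorics.Orbits"
begin

text \<open>The symmetric group on \<open>n\<close> symbols is modelled as the set of functions \<open>\<sigma>\<close> with
  \<open>\<sigma> permutes {1..n}\<close>. The (supports of the) cycles of \<open>\<sigma>\<close> are the orbits of the points of
  \<open>{1..n}\<close>; in particular, fixed points are cycles of length 1.\<close>

definition cycle_count :: "nat \<Rightarrow> (nat \<Rightarrow> nat) \<Rightarrow> nat \<Rightarrow> nat" where
  "cycle_count n \<sigma> j = card {C \<in> orbit \<sigma> ` {1..n}. card C = j}"

definition nu :: "nat \<Rightarrow> nat \<Rightarrow> real" where
  "nu n r = real (card {\<sigma>. \<sigma> permutes {1..n} \<and> (\<forall>j\<in>{r + 1..n}. cycle_count n \<sigma> j = 0)}) / fact n"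

text \<open>Only the values for \<open>1 \<le> k \<le> r\<close> are meaningful.\<close>

definition d_coeff :: "nat \<Rightarrow> nat \<Rightarrow> real" where
  "d_coeff r k =
     (if k = r then - (1 / real r) * (\<Sum>j=2..r. 1 / real j)
      else Gamma (real k + real k / real r) /
           ((real r - real k) * Gamma (real k + 1) * Gamma (1 + real k / real r)))"

end

theory Submission
  imports Defs "HOL-Complex_Analysis.Complex_Analysis" "HOL-Probability.Probability"
    "HOL-Real_Asymp.Real_Asymp"
begin

text \<open>
  The proportion \<open>nu n r\<close> is the coefficient of \<open>z ^ n\<close> in \<open>exp (h z)\<close>, where
  \<open>h z = (\<Sum>j=1..r. z ^ j / j)\<close>: both satisfy the recurrence obtained by splitting off the cycle of a
  marked point (lemma \<open>nu_eq_egf_coeff\<close>). The coefficient is a Cauchy integral over a circle of radius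
  \<open>x\<close>, and the asymptotics come from the saddle point method with one choice of \<open>x\<close> that works
  uniformly in \<open>r\<close>.

  The exact saddle point solves \<open>x + x ^ 2 + \<dots> + x ^ r = n\<close>. Let instead \<open>x = 1 / t\<close> where
  \<open>t ^ r * (1 - t) = 1 / n\<close>, that is, extend the geometric sum downwards to infinity. The sum then
  misses \<open>n\<close> by only \<open>1 / (1 - t)\<close>, which is at most 3 because \<open>t \<le> 2 / 3\<close> can be arranged. At angle
  \<open>\<theta>\<close> this changes the phase of the integrand by at most \<open>3 * \<bar>\<theta>\<bar>\<close>, which is small on the scale
  \<open>1 / sqrt (r * n)\<close> of the approximating Gaussian \<open>exp (- r * n * \<theta> ^ 2 / 2)\<close>. Comparing the integrand
  with this Gaussian pointwise on the whole line gives
  \<open>nu n r = exp (h x + n * ln t) / sqrt (2 * pi * n * r) * (1 + O(t + sqrt (r / n)))\<close>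
  (lemma \<open>nu_near_saddle\<close>). Both error terms are \<open>O(n powr (-1 / r))\<close> when \<open>r \<ge> 2\<close>.

  The advantage of this \<open>t\<close> is that \<open>u = n powr (-1 / r) = t * (1 - t) powr (1 / r)\<close> is an explicit
  function of \<open>t\<close>. Hence the exponent, multiplied by \<open>t ^ r\<close>, and every \<open>t ^ r * n powr ((r - k) / r)\<close>
  are explicit power series in \<open>t\<close>, and the claimed expansion of the exponent becomes an identity
  between their coefficients up to order \<open>r\<close>, together with a bound for the later coefficients (lemma
  \<open>saddle_exponent\<close>). The numbers \<open>d_coeff r k\<close> are, up to the factor \<open>r / (r - k)\<close>, the
  coefficients of \<open>ln (t / u)\<close> as a series in \<open>u\<close>; the case of the Lagrange inversion formula that
  identifies them reduces to the vanishing of the \<open>m\<close>-th finite difference of a polynomial of degree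
  \<open>m - 1\<close> (lemma \<open>sum_negbin_mult_negbin\<close>).

  For \<open>r = 1\<close> the statement is Stirling's formula with relative error \<open>O(1 / n)\<close>, while the saddle point
  bound yields only \<open>O(1 / sqrt n)\<close>. This already gives the limit, and summing the differences of
  consecutive logarithmic errors upgrades the rate (lemma \<open>nu_1_main_term\<close>).
\<close>

section \<open>Counting permutations by the cycle of a marked point\<close>

definition short_perms :: "nat \<Rightarrow> 'b set \<Rightarrow> ('b \<Rightarrow> 'b) set" where
  "short_perms r S = {\<sigma>. \<sigma> permutes S \<and> (\<forall>y\<in>S. card (orbit \<sigma> y) \<le> r)}"

text \<open>
  The cycle of the marked point \<open>a\<close> is exempt from the bound \<open>r\<close>, so that its other points can be removed
  from \<open>S\<close> one at a time without leaving this family of sets.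
\<close>

definition marked_perms :: "nat \<Rightarrow> 'b set \<Rightarrow> 'b \<Rightarrow> nat \<Rightarrow> ('b \<Rightarrow> 'b) set" where
  "marked_perms r S a j = {\<sigma>. \<sigma> permutes S \<and> card (orbit \<sigma> a) = j \<and>
     (\<forall>y\<in>S - orbit \<sigma> a. card (orbit \<sigma> y) \<le> r)}"

lemma permutes_self_in_orbit:
  assumes "\<sigma> permutes S" "finite S"
  shows "y \<in> orbit \<sigma> y"
  by (rule permutation_self_in_orbit) (use assms permutation_permutes in blast)

lemma orbit_eq_if_in_orbit:
  assumes "\<sigma> permutes S" "finite S" "y \<in> orbit \<sigma> x"
  shows "orbit \<sigma> y = orbit \<sigma> x"
  by (rule orbit_cyclic_eq3[OF cyclic_on_orbit[OF assms(1,2)] assms(3)])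

text \<open>
  Composing with the transposition of \<open>a\<close> and a fixed point \<open>b\<close> inserts \<open>b\<close> into the cycle of \<open>a\<close>, directly
  after \<open>a\<close>; the following lemma adds that all other cycles stay as they are.
\<close>

lemma orbit_insert_point:
  assumes \<tau>: "\<tau> permutes S" "finite S" and b: "\<tau> b = b" and ab: "a \<noteq> b"
  shows "orbit (\<tau> \<circ> Transposition.transpose a b) a = insert b (orbit \<tau> a)"
proof -
  define \<sigma> where "\<sigma> = \<tau> \<circ> Transposition.transpose a b"
  have sa: "\<sigma> a = b" and sb: "\<sigma> b = \<tau> a" and so: "\<And>y. y \<noteq> a \<Longrightarrow> y \<noteq> b \<Longrightarrow> \<sigma> y = \<tau> y"
    using b ab by (auto simp: \<sigma>_def)
  have sub: "orbit \<sigma> a \<subseteq> insert b (orbit \<tau> a)"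
  proof
    fix y assume "y \<in> orbit \<sigma> a"
    then show "y \<in> insert b (orbit \<tau> a)"
    proof induction
      case base show ?case using sa by simp
    next
      case (step y)
      then show ?case using sa sb so[of y]
        by (cases "y = a"; cases "y = b") (auto intro: orbit.intros)
    qed
  qed
  have b_in: "b \<in> orbit \<sigma> a" using orbit.base[of \<sigma> a] sa by simp
  have ta: "\<tau> a \<in> orbit \<sigma> a" using orbit.step[OF b_in] sb by simp
  have "y \<in> orbit \<sigma> a" if "y \<in> orbit \<tau> a" for y using that
  proof induction
    case base show ?case by (rule ta)
  next
    case (step y)
    then show ?case using ta b b_in so[of y] orbit.step[of y \<sigma> a]
      by (cases "y = a"; cases "y = b") auto
  qed
  with b_in have "insert b (orbit \<tau> a) \<subseteq> orbit \<sigma> a" by auto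
  with sub show ?thesis unfolding \<sigma>_def by auto
qed

lemma orbit_insert_point_other:
  assumes \<tau>: "\<tau> permutes S" "finite S" and b: "\<tau> b = b" and y: "y \<noteq> b" "y \<notin> orbit \<tau> a"
  shows "orbit (\<tau> \<circ> Transposition.transpose a b) y = orbit \<tau> y"
proof (rule orbit_cong)
  show "y \<in> orbit \<tau> y" by (rule permutes_self_in_orbit[OF \<tau>])
  fix z assume z: "z \<in> orbit \<tau> y"
  have "orbit \<tau> b = {b}" using b by (simp add: orbit_eq_singleton_iff)
  then have "z \<noteq> b" using orbit_eq_if_in_orbit[OF \<tau> z] permutes_self_in_orbit[OF \<tau>, of y] y by auto
  moreover have "z \<noteq> a" using orbit_eq_if_in_orbit[OF \<tau> z] permutes_self_in_orbit[OF \<tau>, of y] y by auto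
  ultimately show "(\<tau> \<circ> Transposition.transpose a b) z = \<tau> z" by simp
qed

lemma marked_perms_1:
  assumes "finite S" "a \<in> S"
  shows "marked_perms r S a 1 = short_perms r (S - {a})"
proof (intro set_eqI iffI)
  fix \<sigma> assume s: "\<sigma> \<in> marked_perms r S a 1"
  then have p: "\<sigma> permutes S" by (simp add: marked_perms_def)
  from s have "card (orbit \<sigma> a) = 1" by (simp add: marked_perms_def)
  then obtain z where "orbit \<sigma> a = {z}" by (rule card_1_singletonE)
  with permutes_self_in_orbit[OF p assms(1), of a] have o: "orbit \<sigma> a = {a}" by auto
  then have "\<sigma> a = a" by (simp add: orbit_eq_singleton_iff)
  then have "\<sigma> permutes (S - {a})" by (intro permutes_superset[OF p]) auto
  with s o show "\<sigma> \<in> short_perms r (S - {a})" by (auto simp: marked_perms_def short_perms_def)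
next
  fix \<sigma> assume s: "\<sigma> \<in> short_perms r (S - {a})"
  then have p: "\<sigma> permutes (S - {a})" by (simp add: short_perms_def)
  then have "\<sigma> a = a" by (simp add: permutes_not_in)
  then have "orbit \<sigma> a = {a}" by (simp add: orbit_eq_singleton_iff)
  with s permutes_subset[OF p, of S] show "\<sigma> \<in> marked_perms r S a 1"
    by (auto simp: marked_perms_def short_perms_def)
qed

text \<open>
  The successor \<open>b\<close> of the marked point can be cut out of its cycle, and it can be put back by
  composing with the transposition of \<open>a\<close> and \<open>b\<close>.
\<close>

lemma card_marked_perms_Suc:
  assumes fin: "finite S" and a: "a \<in> S" and j: "j \<ge> 1"
  shows "card (marked_perms r S a (Suc j)) = (\<Sum>b\<in>S - {a}. card (marked_perms r (S - {b}) a j))"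
proof -
  let ?f = "\<lambda>(b, \<tau>). \<tau> \<circ> Transposition.transpose a b"
  let ?D = "SIGMA b:S - {a}. marked_perms r (S - {b}) a j"
  have "bij_betw ?f ?D (marked_perms r S a (Suc j))"
  proof (rule bij_betw_byWitness[where f' = "\<lambda>\<sigma>. (\<sigma> a, \<sigma> \<circ> Transposition.transpose a (\<sigma> a))"])
    show "\<forall>p\<in>?D. (\<lambda>\<sigma>. (\<sigma> a, \<sigma> \<circ> Transposition.transpose a (\<sigma> a))) (?f p) = p"
    proof
      fix p assume "p \<in> ?D"
      then obtain b \<tau> where p: "p = (b, \<tau>)" and "b \<in> S" "b \<noteq> a" "\<tau> \<in> marked_perms r (S - {b}) a j"
        by auto
      then have "\<tau> b = b" by (auto simp: marked_perms_def permutes_not_in)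
      then show "(\<lambda>\<sigma>. (\<sigma> a, \<sigma> \<circ> Transposition.transpose a (\<sigma> a))) (?f p) = p"
        by (simp add: p comp_assoc)
    qed
    show "\<forall>\<sigma>\<in>marked_perms r S a (Suc j). ?f (\<sigma> a, \<sigma> \<circ> Transposition.transpose a (\<sigma> a)) = \<sigma>"
      by (simp add: comp_assoc)
    show "?f ` ?D \<subseteq> marked_perms r S a (Suc j)"
    proof
      fix \<sigma> assume "\<sigma> \<in> ?f ` ?D"
      then obtain b \<tau> where \<sigma>: "\<sigma> = \<tau> \<circ> Transposition.transpose a b" and b: "b \<in> S" "b \<noteq> a"
        and t: "\<tau> \<in> marked_perms r (S - {b}) a j" by auto
      from t have p: "\<tau> permutes (S - {b})" and c: "card (orbit \<tau> a) = j" by (auto simp: marked_perms_def)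
      from p have tb: "\<tau> b = b" by (auto simp: permutes_not_in)
      have fin': "finite (S - {b})" using fin by simp
      have o: "orbit (\<tau> \<circ> Transposition.transpose a b) a = insert b (orbit \<tau> a)"
        using orbit_insert_point[OF p fin' tb] b by auto
      have oa: "orbit \<tau> a \<subseteq> S - {b}" by (rule permutes_orbit_subset[OF p]) (use a b in auto)
      have "\<tau> \<circ> Transposition.transpose a b permutes S"
        by (rule permutes_compose[OF permutes_swap_id permutes_subset[OF p]]) (use a b in auto)
      moreover have "card (insert b (orbit \<tau> a)) = Suc j"
        using oa c finite_subset[OF oa] fin by (subst card_insert_disjoint) auto
      moreover have "card (orbit (\<tau> \<circ> Transposition.transpose a b) y) \<le> r"
        if "y \<in> S - insert b (orbit \<tau> a)" for y
        using orbit_insert_point_other[OF p fin' tb, of y a] that t by (auto simp: marked_perms_def)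
      ultimately show "\<sigma> \<in> marked_perms r S a (Suc j)"
        by (simp add: \<sigma> marked_perms_def o)
    qed
    show "(\<lambda>\<sigma>. (\<sigma> a, \<sigma> \<circ> Transposition.transpose a (\<sigma> a))) ` marked_perms r S a (Suc j) \<subseteq> ?D"
    proof
      fix p assume "p \<in> (\<lambda>\<sigma>. (\<sigma> a, \<sigma> \<circ> Transposition.transpose a (\<sigma> a))) ` marked_perms r S a (Suc j)"
      then obtain \<sigma> where p': "p = (\<sigma> a, \<sigma> \<circ> Transposition.transpose a (\<sigma> a))"
        and s: "\<sigma> \<in> marked_perms r S a (Suc j)" by auto
      define b where "b = \<sigma> a"
      define \<tau> where "\<tau> = \<sigma> \<circ> Transposition.transpose a b"
      from s have p: "\<sigma> permutes S" and c: "card (orbit \<sigma> a) = Suc j" by (auto simp: marked_perms_def)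
      have "b \<noteq> a"
      proof
        assume "b = a"
        then have "orbit \<sigma> a = {a}" by (simp add: orbit_eq_singleton_iff b_def)
        with c j show False by simp
      qed
      have bS: "b \<in> S" using p a by (simp add: b_def permutes_in_image)
      have tb: "\<tau> b = b" by (simp add: \<tau>_def b_def)
      have "\<tau> permutes S" unfolding \<tau>_def
        by (rule permutes_compose[OF permutes_swap_id p]) (use a bS in auto)
      then have pt: "\<tau> permutes (S - {b})" by (rule permutes_superset) (use tb in auto)
      have st: "\<sigma> = \<tau> \<circ> Transposition.transpose a b" by (simp add: \<tau>_def comp_assoc)
      have fin': "finite (S - {b})" using fin by simp
      have o: "orbit \<sigma> a = insert b (orbit \<tau> a)"
        unfolding st using orbit_insert_point[OF pt fin' tb] \<open>b \<noteq> a\<close> by auto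
      have oa: "orbit \<tau> a \<subseteq> S - {b}" by (rule permutes_orbit_subset[OF pt]) (use a \<open>b \<noteq> a\<close> in auto)
      have "card (insert b (orbit \<tau> a)) = Suc (card (orbit \<tau> a))"
        using oa finite_subset[OF oa] fin by (subst card_insert_disjoint) auto
      with c o have "card (orbit \<tau> a) = j" by simp
      moreover have "card (orbit \<tau> y) \<le> r" if "y \<in> S - {b} - orbit \<tau> a" for y
      proof -
        have "y \<in> S - orbit \<sigma> a" using that o by auto
        then have "card (orbit \<sigma> y) \<le> r" using s by (simp add: marked_perms_def)
        moreover have "orbit \<sigma> y = orbit \<tau> y"
          unfolding st using that by (intro orbit_insert_point_other[OF pt fin' tb]) auto
        ultimately show ?thesis by simp
      qed
      ultimately have "\<tau> \<in> marked_perms r (S - {b}) a j" using pt by (auto simp: marked_perms_def)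
      with bS \<open>b \<noteq> a\<close> show "p \<in> ?D"
        by (simp add: p' b_def[symmetric] \<tau>_def)
    qed
  qed
  then have "card (marked_perms r S a (Suc j)) = card ?D" by (rule bij_betw_same_card[symmetric])
  also have "\<dots> = (\<Sum>b\<in>S - {a}. card (marked_perms r (S - {b}) a j))"
    by (rule card_SigmaI) (use fin in \<open>auto simp: marked_perms_def intro: finite_subset[OF _ finite_permutations]\<close>)
  finally show ?thesis .
qed

lemma short_perms_eq_UN_marked:
  assumes fin: "finite S" and a: "a \<in> S"
  shows "short_perms r S = (\<Union>j\<in>{1..min r (card S)}. marked_perms r S a j)"
proof (intro set_eqI iffI)
  fix \<sigma> assume s: "\<sigma> \<in> short_perms r S"
  then have p: "\<sigma> permutes S" by (simp add: short_perms_def)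
  have sub: "orbit \<sigma> a \<subseteq> S" by (rule permutes_orbit_subset[OF p a])
  have "card (orbit \<sigma> a) \<le> card S" by (rule card_mono[OF fin sub])
  moreover have "card (orbit \<sigma> a) \<noteq> 0"
    using permutes_self_in_orbit[OF p fin, of a] finite_subset[OF sub fin] by auto
  moreover have "card (orbit \<sigma> a) \<le> r" using s a by (simp add: short_perms_def)
  ultimately show "\<sigma> \<in> (\<Union>j\<in>{1..min r (card S)}. marked_perms r S a j)"
    using s by (auto simp: short_perms_def marked_perms_def)
next
  fix \<sigma> assume "\<sigma> \<in> (\<Union>j\<in>{1..min r (card S)}. marked_perms r S a j)"
  then have p: "\<sigma> permutes S" and r: "card (orbit \<sigma> a) \<le> r"
    and o: "\<forall>y\<in>S - orbit \<sigma> a. card (orbit \<sigma> y) \<le> r" by (auto simp: marked_perms_def)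
  have "card (orbit \<sigma> y) \<le> r" if "y \<in> S" for y
    using o r that orbit_eq_if_in_orbit[OF p fin, of y a] by (cases "y \<in> orbit \<sigma> a") auto
  with p show "\<sigma> \<in> short_perms r S" by (simp add: short_perms_def)
qed

lemma card_short_perms_rec:
  assumes fin: "finite S" and a: "a \<in> S"
  shows "card (short_perms r S) = (\<Sum>j=1..min r (card S). card (marked_perms r S a j))"
  unfolding short_perms_eq_UN_marked[OF assms]
  by (rule card_UN_disjoint)
     (use fin in \<open>auto simp: marked_perms_def intro: finite_subset[OF _ finite_permutations]\<close>)

text \<open>
  By lemma \<open>card_marked_perms_Suc\<close>, \<open>j - 1\<close> successive removals leave a fixed point \<open>a\<close> and a permutation of
  \<open>card S - j\<close> points, so each length \<open>j\<close> of the cycle of \<open>a\<close> accounts for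
  \<open>fact (card S - 1) * c (card S - j)\<close> permutations. The recurrence for \<open>c\<close> sums these contributions.
\<close>

lemma card_short_perms:
  fixes c :: "nat \<Rightarrow> 'a :: field_char_0"
  assumes c0: "c 0 = 1"
    and c_rec: "\<And>n. of_nat (Suc n) * c (Suc n) = (\<Sum>i<min r (Suc n). c (n - i))"
    and fin: "finite S"
  shows "of_nat (card (short_perms r S)) = fact (card S) * c (card S)"
  using fin
proof (induction "card S" arbitrary: S rule: less_induct)
  case less
  note IH = less.hyps
  show ?case
  proof (cases "S = {}")
    case True
    then have "short_perms r S = {id}" by (auto simp: short_perms_def)
    with True c0 show ?thesis by simp
  next
    case False
    have marked: "of_nat (card (marked_perms r T a j)) = fact (card T - 1) * c (card T - j)"
      if "1 \<le> j" "j \<le> card T" "a \<in> T" "finite T" "card T \<le> card S" for j a and T :: "'b set"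
      using that
    proof (induction j arbitrary: T rule: nat_induct_at_least)
      case base
      then show ?case
        using IH[of "T - {a}"] marked_perms_1[of T a r] by simp
    next
      case (Suc j)
      have "of_nat (card (marked_perms r T a (Suc j))) =
            (\<Sum>b\<in>T - {a}. of_nat (card (marked_perms r (T - {b}) a j)) :: 'a)"
        by (subst card_marked_perms_Suc) (use Suc in auto)
      also have "\<dots> = (\<Sum>b\<in>T - {a}. fact (card T - 2) * c (card T - Suc j))"
        by (rule sum.cong) (use Suc.prems Suc.IH Suc.hyps in \<open>auto simp: numeral_2_eq_2\<close>)
      also have "\<dots> = of_nat (card T - 1) * fact (card T - 2) * c (card T - Suc j)"
        using Suc.prems by simp
      also have "of_nat (card T - 1) * fact (card T - 2) = (fact (card T - 1) :: 'a)"
        using Suc.prems Suc.hyps by (subst fact_reduce[of "card T - 1"]) (auto simp: numeral_2_eq_2)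
      finally show ?case .
    qed
    from False obtain a where a: "a \<in> S" by auto
    define n where "n = card S - 1"
    have n: "card S = Suc n" using a less.prems card_gt_0_iff[of S] by (auto simp: n_def)
    have "of_nat (card (short_perms r S)) = (\<Sum>j=1..min r (Suc n). of_nat (card (marked_perms r S a j)) :: 'a)"
      unfolding card_short_perms_rec[OF less.prems a] n by simp
    also have "\<dots> = (\<Sum>j=1..min r (Suc n). fact n * c (Suc n - j))"
      by (rule sum.cong[OF refl], subst marked) (use a less.prems n in auto)
    also have "\<dots> = fact n * (\<Sum>i<min r (Suc n). c (n - i))"
      unfolding sum_distrib_left
      by (rule sum.reindex_bij_witness[of _ Suc "\<lambda>j. j - 1"]) auto
    also have "\<dots> = fact (card S) * c (card S)"
      unfolding c_rec[symmetric] n by (simp add: algebra_simps)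
    finally show ?thesis .
  qed
qed

lemma nu_eq_card_short_perms: "nu n r = real (card (short_perms r {1..n})) / fact n"
proof -
  have "(\<forall>j\<in>{r+1..n}. cycle_count n \<sigma> j = 0) \<longleftrightarrow> (\<forall>y\<in>{1..n}. card (orbit \<sigma> y) \<le> r)"
    if p: "\<sigma> permutes {1..n}" for \<sigma>
  proof -
    have "card (orbit \<sigma> y) \<le> n" if "y \<in> {1..n}" for y
      using card_mono[OF _ permutes_orbit_subset[OF p that]] by simp
    then have "card (orbit \<sigma> y) \<le> r \<longleftrightarrow> card (orbit \<sigma> y) \<notin> {r+1..n}" if "y \<in> {1..n}" for y
      using that by force
    then have "(\<forall>y\<in>{1..n}. card (orbit \<sigma> y) \<le> r) \<longleftrightarrow> (\<forall>y\<in>{1..n}. card (orbit \<sigma> y) \<notin> {r+1..n})"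
      by (intro ball_cong) simp_all
    also have "\<dots> \<longleftrightarrow> (\<forall>j\<in>{r+1..n}. \<forall>y\<in>{1..n}. card (orbit \<sigma> y) \<noteq> j)" by blast
    also have "\<dots> \<longleftrightarrow> (\<forall>j\<in>{r+1..n}. cycle_count n \<sigma> j = 0)"
      by (auto simp: cycle_count_def)
    finally show ?thesis by simp
  qed
  then show ?thesis by (auto simp: nu_def short_perms_def intro!: arg_cong[where f = card])
qed

lemma nu_pos: "1 \<le> r \<Longrightarrow> nu n r > 0"
proof -
  assume r: "1 \<le> r"
  have "id \<in> short_perms r {1..n}"
  proof -
    have "orbit id y = {y}" for y :: nat by (simp add: orbit_eq_singleton_iff)
    then have "card (orbit id y) \<le> r" for y :: nat using r by simp
    then show ?thesis by (simp add: short_perms_def permutes_id)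
  qed
  moreover have "finite (short_perms r {1..n})"
    by (rule finite_subset[OF _ finite_permutations[of "{1..n}"]]) (auto simp: short_perms_def)
  ultimately have "card (short_perms r {1..n}) > 0" by (auto simp: card_gt_0_iff)
  then show ?thesis by (simp add: nu_eq_card_short_perms)
qed

section \<open>The exponential generating function as a Cauchy integral\<close>

definition cycle_poly :: "nat \<Rightarrow> 'a::real_normed_field \<Rightarrow> 'a" where
  "cycle_poly r z = (\<Sum>j=1..r. z ^ j / of_nat j)"

text \<open>
  The Taylor coefficient at 0 of the entire function \<open>exp (cycle_poly r z)\<close>, defined by derivatives so that
  both the formal power series calculus and Cauchy's formula apply to it.
\<close>

definition egf_coeff :: "nat \<Rightarrow> nat \<Rightarrow> complex" where
  "egf_coeff r n = (deriv ^^ n) (\<lambda>z. exp (cycle_poly r z)) 0 / fact n"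

lemma egf_coeff_0: "egf_coeff r 0 = 1"
  by (simp add: egf_coeff_def cycle_poly_def power_0_left sum.neutral)

lemma holomorphic_cycle_poly [holomorphic_intros]:
  "f holomorphic_on A \<Longrightarrow> (\<lambda>z. cycle_poly r (f z)) holomorphic_on A"
  unfolding cycle_poly_def by (intro holomorphic_intros) auto

lemma cycle_poly_has_field_derivative:
  "((\<lambda>z::complex. cycle_poly r z) has_field_derivative (\<Sum>j<r. z ^ j)) (at z)"
proof -
  have "((\<lambda>z::complex. cycle_poly r z) has_field_derivative
      (\<Sum>j=1..r. of_nat j * z ^ (j - 1) / of_nat j)) (at z)"
    unfolding cycle_poly_def by (auto intro!: derivative_eq_intros)
  also have "(\<Sum>j=1..r. of_nat j * z ^ (j - 1) / of_nat j) = (\<Sum>j<r. z ^ j)"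
    by (rule sum.reindex_bij_witness[of _ Suc "\<lambda>j. j - 1"]) (auto simp del: of_nat_Suc)
  finally show ?thesis .
qed

text \<open>
  Coefficient comparison in \<open>f' = h' * f\<close>, where \<open>f = exp h\<close> and \<open>h' z = (\<Sum>j<r. z ^ j)\<close>.
\<close>

lemma egf_coeff_rec:
  "of_nat (Suc n) * egf_coeff r (Suc n) = (\<Sum>i<min r (Suc n). egf_coeff r (n - i))"
proof -
  let ?f = "\<lambda>z::complex. exp (cycle_poly r z)"
  define F where "F = fps_expansion ?f 0"
  have F: "?f has_fps_expansion F"
    unfolding F_def by (intro analytic_at_imp_has_fps_expansion_0 analytic_intros)
      (auto intro!: holomorphic_intros simp: analytic_on_holomorphic)
  have nth: "fps_nth F k = egf_coeff r k" for k
    by (simp add: F_def fps_expansion_def egf_coeff_def)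
  have "deriv ?f has_fps_expansion fps_deriv F"
    by (rule has_fps_expansion_deriv[OF F])
  also have "deriv ?f = (\<lambda>z. (\<Sum>j<r. z ^ j) * ?f z)"
    by (intro ext DERIV_imp_deriv)
       (auto intro!: derivative_eq_intros cycle_poly_has_field_derivative simp: mult.commute)
  finally have "(\<lambda>z. (\<Sum>j<r. z ^ j) * ?f z) has_fps_expansion fps_deriv F" .
  moreover have "(\<lambda>z. (\<Sum>j<r. z ^ j) * ?f z) has_fps_expansion (\<Sum>j<r. fps_X ^ j) * F"
    by (intro fps_expansion_intros F)
  ultimately have "fps_deriv F = (\<Sum>j<r. fps_X ^ j) * F"
    using fps_expansion_unique_complex by blast
  then have "fps_nth (fps_deriv F) n = fps_nth ((\<Sum>j<r. fps_X ^ j) * F) n" by simp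
  also have "\<dots> = (\<Sum>j<r. fps_nth (fps_X ^ j * F) n)"
    by (simp add: sum_distrib_right fps_sum_nth)
  also have "\<dots> = (\<Sum>j<r. if n < j then 0 else egf_coeff r (n - j))"
    unfolding fps_X_power_mult_nth nth ..
  also have "\<dots> = (\<Sum>i<min r (Suc n). egf_coeff r (n - i))"
    by (rule sum.mono_neutral_cong_right) auto
  finally show ?thesis by (simp add: nth)
qed

text \<open>
  Cauchy's formula on a circle comes with the parameter interval from 0 to \<open>2 * pi\<close>, but the saddle is at
  angle 0, which should be in the interior.
\<close>

lemma integral_shift_period:
  fixes f :: "real \<Rightarrow> 'a::banach"
  assumes f: "continuous_on UNIV f" and per: "\<And>x. f (x + 2 * pi) = f x"
  shows "integral {-pi..pi} f = integral {0..2*pi} f"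
proof -
  have int: "f integrable_on {a..b}" for a b
    by (rule integrable_continuous_interval[OF continuous_on_subset[OF f]]) auto
  have "(f has_integral integral {pi..2*pi} f) (cbox pi (2*pi))"
    using int by (simp add: integrable_integral)
  then have "((\<lambda>x. f (1 *\<^sub>R x + 2 * pi)) has_integral integral {pi..2*pi} f) (cbox (-pi) 0)"
    using has_integral_affinity[of f "integral {pi..2*pi} f" pi "2*pi" 1 "2*pi"] by simp
  then have "(f has_integral integral {pi..2*pi} f) {-pi..0}"
    by (simp add: per)
  then have "integral {-pi..0} f = integral {pi..2*pi} f" by (rule integral_unique)
  moreover have "integral {-pi..0} f + integral {0..pi} f = integral {-pi..pi} f"
    by (rule Henstock_Kurzweil_Integration.integral_combine) (auto intro: int)
  moreover have "integral {0..pi} f + integral {pi..2*pi} f = integral {0..2*pi} f"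
    by (rule Henstock_Kurzweil_Integration.integral_combine) (auto intro: int)
  ultimately show ?thesis by (metis add.commute)
qed

lemma egf_coeff_integral:
  fixes x :: real
  assumes x: "x > 0"
  shows "egf_coeff r n = of_real (1 / (2 * pi * x ^ n)) *
    integral {-pi..pi} (\<lambda>\<theta>. exp (cycle_poly r (of_real x * cis \<theta>)) * cis (- (real n * \<theta>)))"
proof -
  let ?f = "\<lambda>z::complex. exp (cycle_poly r z)"
  let ?g = "\<lambda>\<theta>. ?f (of_real x * cis \<theta>) * cis (- (real n * \<theta>))"
  have "((\<lambda>u. ?f u / (u - 0) ^ Suc n) has_contour_integral (2 * pi * \<i>) / fact n * (deriv ^^ n) ?f 0) (circlepath 0 x)"
    by (rule Cauchy_has_contour_integral_higher_derivative_circlepath)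
       (use x in \<open>auto intro!: holomorphic_intros holomorphic_on_imp_continuous_on\<close>)
  then have "((\<lambda>u. ?f u / u ^ Suc n) has_contour_integral 2 * pi * \<i> * egf_coeff r n) (part_circlepath 0 x 0 (2 * pi))"
    by (simp add: egf_coeff_def circlepath_def)
  then have "((\<lambda>\<theta>. ?f (of_real x * cis \<theta>) / (of_real x * cis \<theta>) ^ Suc n * of_real x * \<i> * cis \<theta>)
      has_integral 2 * pi * \<i> * egf_coeff r n) {0..2 * pi}"
    by (subst (asm) has_contour_integral_part_circlepath_iff) auto
  moreover have "?f (of_real x * cis \<theta>) / (of_real x * cis \<theta>) ^ Suc n * of_real x * \<i> * cis \<theta> =
      \<i> / of_real x ^ n * ?g \<theta>" for \<theta>
  proof -
    have "cis (- (real n * \<theta>)) = 1 / cis \<theta> ^ n"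
      by (simp add: Complex.DeMoivre flip: cis_inverse) (simp add: divide_inverse)
    then show ?thesis using x by (simp add: field_simps power_mult_distrib)
  qed
  ultimately have "((\<lambda>\<theta>. \<i> / of_real x ^ n * ?g \<theta>) has_integral 2 * pi * \<i> * egf_coeff r n) {0..2 * pi}"
    by simp
  from has_integral_mult_right[OF this, of "of_real x ^ n / \<i>"]
  have "(?g has_integral of_real (2 * pi * x ^ n) * egf_coeff r n) {0..2 * pi}"
    using x by (simp add: field_simps)
  then have "integral {0..2*pi} ?g = of_real (2 * pi * x ^ n) * egf_coeff r n"
    by (rule integral_unique)
  moreover have "integral {-pi..pi} ?g = integral {0..2*pi} ?g"
  proof (rule integral_shift_period)
    show "continuous_on UNIV ?g"
      unfolding cycle_poly_def by (intro continuous_intros) auto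
    show "?g (\<theta> + 2 * pi) = ?g \<theta>" for \<theta>
    proof -
      have "cis (- (real n * (\<theta> + 2 * pi))) = cis (- (real n * \<theta>)) * cis (2 * pi * (- real n))"
        by (simp add: cis_mult algebra_simps)
      also have "cis (2 * pi * (- real n)) = 1" by (rule cis_multiple_2pi) auto
      finally show ?thesis by (simp flip: cis_mult)
    qed
  qed
  ultimately show ?thesis using x by simp
qed

lemma nu_eq_egf_coeff: "complex_of_real (nu n r) = egf_coeff r n"
proof -
  have "of_nat (card (short_perms r {1..n})) = fact (card {1..n}) * egf_coeff r (card {1..n})"
    by (rule card_short_perms) (simp_all add: egf_coeff_0 egf_coeff_rec del: of_nat_Suc)
  then show ?thesis by (simp add: nu_eq_card_short_perms)
qed

section \<open>The integral near the saddle point\<close>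

lemma cis_Taylor_2:
  "cmod (cis \<phi> - 1 - \<i> * \<phi> + \<phi>\<^sup>2 / 2) \<le> \<bar>\<phi>\<bar> ^ 3 / 6"
proof -
  have "cmod (iexp \<phi> - (\<Sum>k\<le>2. (\<i> * \<phi>) ^ k / fact k)) \<le> \<bar>\<phi>\<bar> ^ Suc 2 / fact (Suc 2)"
    by (rule iexp_approx1)
  also have "iexp \<phi> - (\<Sum>k\<le>2. (\<i> * \<phi>) ^ k / fact k) = cis \<phi> - 1 - \<i> * \<phi> + \<phi>\<^sup>2 / 2"
    by (simp add: numeral_2_eq_2 cis_conv_exp power_mult_distrib fact_numeral)
  finally show ?thesis by (simp add: fact_numeral numeral_3_eq_3)
qed

lemma pi_squared_bounds: "9 \<le> pi\<^sup>2" "pi\<^sup>2 \<le> 10"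
proof -
  have "3\<^sup>2 \<le> pi\<^sup>2" by (rule power_mono) (use pi_gt3 in auto)
  then show "9 \<le> pi\<^sup>2" by simp
  have "pi \<le> 3.15" using pi_approx by simp
  then have "pi\<^sup>2 \<le> 3.15\<^sup>2" by (rule power_mono) auto
  then show "pi\<^sup>2 \<le> 10" by (simp add: power2_eq_square)
qed

text \<open>
  The error term of the second-order Taylor polynomial is at most \<open>\<phi> ^ 4 / 24\<close>, which is at most
  \<open>10 * \<phi> ^ 2 / 24\<close>, and \<open>1 / 2 - 10 / 24 = 1 / 12\<close>.
\<close>

lemma one_minus_cos_ge:
  assumes "\<bar>\<phi>\<bar> \<le> pi"
  shows "\<phi>\<^sup>2 / 12 \<le> 1 - cos \<phi>"
proof -
  have "cmod (iexp \<phi> - (\<Sum>k\<le>3. (\<i> * \<phi>) ^ k / fact k)) \<le> \<bar>\<phi>\<bar> ^ Suc 3 / fact (Suc 3)"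
    by (rule iexp_approx1)
  with abs_Re_le_cmod have "\<bar>Re (iexp \<phi> - (\<Sum>k\<le>3. (\<i> * \<phi>) ^ k / fact k))\<bar> \<le> \<bar>\<phi>\<bar> ^ Suc 3 / fact (Suc 3)"
    by (rule order_trans)
  moreover have "Re (iexp \<phi> - (\<Sum>k\<le>3. (\<i> * \<phi>) ^ k / fact k)) = cos \<phi> - 1 + \<phi>\<^sup>2 / 2"
    by (simp add: numeral_3_eq_3 numeral_2_eq_2 flip: cis_conv_exp)
  moreover have "\<bar>\<phi>\<bar> ^ Suc 3 / fact (Suc 3) = \<bar>\<phi>\<bar> ^ 4 / 24"
    by (simp add: fact_numeral eval_nat_numeral)
  ultimately have "\<bar>cos \<phi> - 1 + \<phi>\<^sup>2 / 2\<bar> \<le> \<bar>\<phi>\<bar> ^ 4 / 24"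
    by (simp only:)
  moreover have "\<bar>\<phi>\<bar> ^ 4 \<le> 10 * \<phi>\<^sup>2"
  proof -
    have "\<phi>\<^sup>2 \<le> pi\<^sup>2" using assms by (metis abs_ge_zero power2_abs power_mono)
    then have "\<phi>\<^sup>2 * \<phi>\<^sup>2 \<le> 10 * \<phi>\<^sup>2" using pi_squared_bounds by (intro mult_right_mono) auto
    moreover have "\<bar>\<phi>\<bar> ^ 4 = \<phi>\<^sup>2 * \<phi>\<^sup>2" by (simp add: eval_nat_numeral)
    ultimately show ?thesis by simp
  qed
  ultimately show ?thesis by linarith
qed

text \<open>
  This is \<open>\<bar>1 - cis (a - b)\<bar> ^ 2 \<le> 2 * \<bar>1 - cis a\<bar> ^ 2 + 2 * \<bar>1 - cis b\<bar> ^ 2\<close> in real terms. Two terms of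
  \<open>h\<close> with consecutive exponents therefore cannot both be near their maximum unless the angle is near 0.
\<close>

lemma one_minus_cos_diff_le: "1 - cos (a - b :: real) \<le> 2 * (1 - cos a) + 2 * (1 - cos b)"
proof -
  have "0 \<le> (sin a + sin b)\<^sup>2 + (cos a + cos b - 2)\<^sup>2" by simp
  also have "(sin a + sin b)\<^sup>2 + (cos a + cos b - 2)\<^sup>2 = ((sin a)\<^sup>2 + (cos a)\<^sup>2) + ((sin b)\<^sup>2 + (cos b)\<^sup>2)
      + 2 * (cos a * cos b + sin a * sin b) - 4 * cos a - 4 * cos b + 4"
    by algebra
  also have "\<dots> = 6 + 2 * cos (a - b) - 4 * cos a - 4 * cos b" by (simp add: cos_diff)
  finally have "2 * (1 - cos (a - b)) \<le> 2 * (2 * (1 - cos a) + 2 * (1 - cos b))"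
    by (simp add: algebra_simps)
  then show ?thesis by simp
qed

text \<open>
  The mean value inequality on the half-plane of all \<open>z\<close> with \<open>Re z \<le> M\<close>, where the derivative of \<open>exp\<close> is
  bounded by \<open>exp M\<close>.
\<close>

lemma cmod_exp_diff_le:
  fixes a b :: complex
  assumes "Re a \<le> M" "Re b \<le> M"
  shows "cmod (exp a - exp b) \<le> exp M * cmod (a - b)"
  by (rule field_differentiable_bound[of "{z. Re z \<le> M}" exp exp])
     (use assms in \<open>auto intro!: derivative_eq_intros convex_halfspace_Re_le\<close>)

lemma abs_exp_minus_one_le:
  fixes y :: real
  assumes "\<bar>y\<bar> \<le> M"
  shows "\<bar>exp y - 1\<bar> \<le> exp M * \<bar>y\<bar>"
proof -
  have "cmod (exp (of_real y) - exp (of_real 0)) \<le> exp M * cmod (of_real y - of_real 0)"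
    by (rule cmod_exp_diff_le) (use assms in auto)
  then show ?thesis by (simp only: exp_of_real norm_of_real flip: of_real_diff) simp
qed

text \<open>
  The logarithm of the Cauchy integrand, normalised to vanish at \<open>\<theta> = 0\<close>.
\<close>

definition saddle_phase :: "nat \<Rightarrow> nat \<Rightarrow> real \<Rightarrow> real \<Rightarrow> complex" where
  "saddle_phase r n x \<theta> =
     cycle_poly r (of_real x * cis \<theta>) - of_real (cycle_poly r x) - \<i> * of_real (real n * \<theta>)"

lemma saddle_phase_eq:
  "saddle_phase r n x \<theta> = (\<Sum>j=1..r. of_real (x ^ j / real j) * (cis (real j * \<theta>) - 1)) - \<i> * of_real (real n * \<theta>)"
proof -
  have "cycle_poly r (of_real x * cis \<theta>) - of_real (cycle_poly r x) =
      (\<Sum>j=1..r. of_real (x ^ j / real j) * (cis (real j * \<theta>) - 1))"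
    unfolding cycle_poly_def of_real_sum sum_subtractf[symmetric]
    by (rule sum.cong) (simp_all add: power_mult_distrib Complex.DeMoivre right_diff_distrib)
  then show ?thesis by (simp add: saddle_phase_def)
qed

lemma Re_saddle_phase:
  "Re (saddle_phase r n x \<theta>) = - (\<Sum>j=1..r. x ^ j / real j * (1 - cos (real j * \<theta>)))"
  by (simp add: saddle_phase_eq sum_negf[symmetric] right_diff_distrib)

text \<open>
  The radius \<open>x = 1 / t\<close> satisfies \<open>x ^ r / (1 - t) = n\<close>, the saddle point equation with the finite geometric
  sum \<open>x ^ r + \<dots> + x\<close> replaced by the infinite one in decreasing powers of \<open>x\<close>.
\<close>

locale near_saddle =
  fixes r n :: nat and t x :: real
  assumes r: "r \<ge> 1" and n: "n \<ge> 1" and t: "0 < t" "t \<le> 2 / 3"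
    and n_eq: "real n * (t ^ r * (1 - t)) = 1"
    and x_def: "x = 1 / t"
begin

lemma x_pos: "x > 0" using t by (simp add: x_def)

lemma x_power_r: "x ^ r = real n * (1 - t)"
  using n_eq t by (simp add: x_def power_divide field_simps)

lemma x_power_r_ge: "real n / 3 \<le> x ^ r"
  unfolding x_power_r using mult_left_mono[of "1/3" "1 - t" "real n"] t by simp

lemma sum_x_powers: "(\<Sum>j=1..r. x ^ j) = real n - 1 / (1 - t)"
proof -
  have "(\<Sum>j=1..r. x ^ j) * (1 - t) = x ^ r - 1"
  proof -
    have "(\<Sum>j=1..k. x ^ j) * (1 - t) = x ^ k - 1" for k
    proof (induction k)
      case (Suc k)
      have "(\<Sum>j=1..Suc k. x ^ j) * (1 - t) = (\<Sum>j=1..k. x ^ j) * (1 - t) + x ^ Suc k - x ^ Suc k * t"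
        by (simp add: algebra_simps)
      moreover have "x ^ Suc k * t = x ^ k" using t by (simp add: x_def)
      ultimately show ?case using Suc by simp
    qed simp
    then show ?thesis by blast
  qed
  then show ?thesis using t by (simp add: x_power_r field_simps)
qed

lemma sum_x_powers_le: "(\<Sum>j=1..r. x ^ j) \<le> real n"
  unfolding sum_x_powers using t by simp

lemma sum_x_powers_near: "\<bar>(\<Sum>j=1..r. x ^ j) - real n\<bar> \<le> 3"
proof -
  have "0 \<le> 1 / (1 - t)" "1 / (1 - t) \<le> 3" using t by (auto simp: field_simps)
  then show ?thesis unfolding sum_x_powers by linarith
qed

lemma sum_j_x_powers_near: "\<bar>(\<Sum>j=1..r. real j * x ^ j) - real r * real n\<bar> \<le> real r * real n * t"
proof -
  have "(\<Sum>j=1..r. real j * x ^ j) \<le> (\<Sum>j=1..r. real r * x ^ j)"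
    by (rule sum_mono) (use x_pos in auto)
  also have "\<dots> \<le> real r * real n"
    unfolding sum_distrib_left[symmetric] by (rule mult_left_mono[OF sum_x_powers_le]) simp
  finally have le: "(\<Sum>j=1..r. real j * x ^ j) \<le> real r * real n" .
  have "real r * x ^ r \<le> (\<Sum>j=1..r. real j * x ^ j)"
    using member_le_sum[of r "{1..r}" "\<lambda>j. real j * x ^ j"] r x_pos by simp
  then have "real r * real n - real r * real n * t \<le> (\<Sum>j=1..r. real j * x ^ j)"
    unfolding x_power_r by (simp add: algebra_simps)
  with le show ?thesis by linarith
qed

lemma sum_j2_x_powers_le: "(\<Sum>j=1..r. (real j)\<^sup>2 * x ^ j) \<le> (real r)\<^sup>2 * real n"
proof -
  have "(\<Sum>j=1..r. (real j)\<^sup>2 * x ^ j) \<le> (\<Sum>j=1..r. (real r)\<^sup>2 * x ^ j)"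
    by (intro sum_mono mult_right_mono power_mono) (use x_pos in auto)
  also have "\<dots> \<le> (real r)\<^sup>2 * real n"
    unfolding sum_distrib_left[symmetric] by (rule mult_left_mono[OF sum_x_powers_le]) simp
  finally show ?thesis .
qed

text \<open>
  In the second-order expansion of each \<open>cis (j * \<theta>)\<close> the three error terms are, in order: the drift because
  \<open>x\<close> is not the exact saddle point, the difference between the variance \<open>\<Sum>j=1..r. j * x ^ j\<close> and its
  approximation \<open>r * n\<close>, and the cubic remainders.
\<close>

lemma saddle_phase_near_gaussian:
  "cmod (saddle_phase r n x \<theta> - of_real (- (real r * real n * \<theta>\<^sup>2 / 2))) \<le>
     3 * \<bar>\<theta>\<bar> + real r * real n * t * \<theta>\<^sup>2 / 2 + (real r)\<^sup>2 * real n * \<bar>\<theta>\<bar> ^ 3 / 6"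
proof -
  let ?A = "\<Sum>j=1..r. x ^ j" and ?B = "\<Sum>j=1..r. real j * x ^ j"
  define R where "R = (\<lambda>j. cis (real j * \<theta>) - 1 - \<i> * (real j * \<theta>) + (real j * \<theta>)\<^sup>2 / 2)"
  have "saddle_phase r n x \<theta> - of_real (- (real r * real n * \<theta>\<^sup>2 / 2)) =
    (\<Sum>j=1..r. of_real (x ^ j / real j) * R j + (\<i> * of_real (\<theta> * x ^ j) - of_real (\<theta>\<^sup>2 / 2 * (real j * x ^ j))))
    - \<i> * of_real (real n * \<theta>) + of_real (real r * real n * \<theta>\<^sup>2 / 2)"
  proof -
    have "of_real (x ^ j / real j) * (cis (real j * \<theta>) - 1) =
        of_real (x ^ j / real j) * R j + (\<i> * of_real (\<theta> * x ^ j) - of_real (\<theta>\<^sup>2 / 2 * (real j * x ^ j)))"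
      if "j \<in> {1..r}" for j
      using that by (simp add: R_def power2_eq_square field_simps)
    then show ?thesis by (simp add: saddle_phase_eq)
  qed
  also have "\<dots> = (\<Sum>j=1..r. of_real (x ^ j / real j) * R j) + \<i> * of_real (\<theta> * (?A - real n))
      - of_real (\<theta>\<^sup>2 / 2 * (?B - real r * real n))"
    unfolding sum.distrib sum_subtractf
    by (simp add: sum_distrib_left algebra_simps)
  also have "cmod \<dots> \<le> cmod (\<Sum>j=1..r. of_real (x ^ j / real j) * R j) + cmod (\<i> * of_real (\<theta> * (?A - real n)))
      + cmod (of_real (\<theta>\<^sup>2 / 2 * (?B - real r * real n)))"
    by (meson norm_triangle_ineq norm_triangle_ineq4 order_trans add_right_mono)
  also have "cmod (\<i> * of_real (\<theta> * (?A - real n))) \<le> 3 * \<bar>\<theta>\<bar>"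
    unfolding norm_mult norm_of_real abs_mult
    using mult_left_mono[OF sum_x_powers_near, of "\<bar>\<theta>\<bar>"] by (simp add: mult.commute)
  also have "cmod (of_real (\<theta>\<^sup>2 / 2 * (?B - real r * real n))) \<le> real r * real n * t * \<theta>\<^sup>2 / 2"
    unfolding norm_of_real abs_mult
    using mult_left_mono[OF sum_j_x_powers_near, of "\<bar>\<theta>\<^sup>2 / 2\<bar>"] by (simp add: mult_ac)
  also have "cmod (\<Sum>j=1..r. of_real (x ^ j / real j) * R j) \<le> (real r)\<^sup>2 * real n * \<bar>\<theta>\<bar> ^ 3 / 6"
  proof -
    have "cmod (\<Sum>j=1..r. of_real (x ^ j / real j) * R j) \<le> (\<Sum>j=1..r. (real j)\<^sup>2 * x ^ j * (\<bar>\<theta>\<bar> ^ 3 / 6))"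
    proof (rule sum_norm_le)
      fix j assume j: "j \<in> {1..r}"
      have "cmod (of_real (x ^ j / real j) * R j) = x ^ j / real j * cmod (R j)"
        using x_pos by (simp add: norm_mult norm_divide norm_power)
      also have "\<dots> \<le> x ^ j / real j * (\<bar>real j * \<theta>\<bar> ^ 3 / 6)"
        unfolding R_def by (rule mult_left_mono[OF cis_Taylor_2]) (use x_pos in auto)
      also have "\<dots> = (real j)\<^sup>2 * x ^ j * (\<bar>\<theta>\<bar> ^ 3 / 6)"
        using j by (simp add: abs_mult power_mult_distrib eval_nat_numeral)
      finally show "cmod (of_real (x ^ j / real j) * R j) \<le> (real j)\<^sup>2 * x ^ j * (\<bar>\<theta>\<bar> ^ 3 / 6)" .
    qed
    also have "\<dots> \<le> (real r)\<^sup>2 * real n * (\<bar>\<theta>\<bar> ^ 3 / 6)"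
      unfolding sum_distrib_right[symmetric] by (rule mult_right_mono[OF sum_j2_x_powers_le]) auto
    finally show ?thesis by simp
  qed
  finally show ?thesis by simp
qed

text \<open>
  All terms of the sum for the real part have the same sign, so the one with \<open>j = r\<close> suffices as long as
  its angle \<open>r * \<theta>\<close> stays within \<open>pi\<close>.
\<close>

lemma Re_saddle_phase_major:
  assumes "real r * \<bar>\<theta>\<bar> \<le> pi"
  shows "Re (saddle_phase r n x \<theta>) \<le> - (real r * real n * \<theta>\<^sup>2 / 36)"
proof -
  have "real n / 3 / real r * ((real r * \<theta>)\<^sup>2 / 12) \<le> x ^ r / real r * (1 - cos (real r * \<theta>))"
    by (intro mult_mono divide_right_mono x_power_r_ge one_minus_cos_ge)
       (use assms x_pos in \<open>auto simp: abs_mult\<close>)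
  also have "\<dots> \<le> (\<Sum>j=1..r. x ^ j / real j * (1 - cos (real j * \<theta>)))"
    using member_le_sum[of r "{1..r}" "\<lambda>j. x ^ j / real j * (1 - cos (real j * \<theta>))"] r x_pos by simp
  also have "real n / 3 / real r * ((real r * \<theta>)\<^sup>2 / 12) = real r * real n * \<theta>\<^sup>2 / 36"
    using r by (simp add: power2_eq_square field_simps)
  finally show ?thesis by (simp add: Re_saddle_phase)
qed

text \<open>
  Away from 0 the term with \<open>j = r\<close> alone may vanish, namely when \<open>r * \<theta>\<close> is a multiple of \<open>2 * pi\<close>. The
  angles for \<open>j = r\<close> and \<open>j = r - 1\<close> differ by \<open>\<theta>\<close>, so these two terms together give a lower bound of order
  \<open>\<theta> ^ 2\<close>.
\<close>

lemma Re_saddle_phase_minor: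
  assumes "pi < real r * \<bar>\<theta>\<bar>" "\<bar>\<theta>\<bar> \<le> pi"
  shows "r \<ge> 2" "Re (saddle_phase r n x \<theta>) \<le> - (real n * t / (9 * real r ^ 3))"
proof -
  show r2: "r \<ge> 2"
  proof (rule ccontr)
    assume "\<not> r \<ge> 2"
    with r have "r = 1" by simp
    with assms show False by simp
  qed
  define f where "f = (\<lambda>j. x ^ j / real j * (1 - cos (real j * \<theta>)))"
  have x1: "x \<ge> 1" using t by (simp add: x_def)
  have f0: "f j \<ge> 0" for j using x_pos by (simp add: f_def)
  let ?w = "x ^ (r - 1) / real r"
  have w0: "?w \<ge> 0" using x_pos by simp
  have "3 / 8 / (real r)\<^sup>2 \<le> (1 - cos \<theta>) / 2"
  proof -
    have "pi\<^sup>2 \<le> (real r * \<bar>\<theta>\<bar>)\<^sup>2" by (rule power_mono) (use assms in auto)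
    then have "9 \<le> (real r)\<^sup>2 * \<theta>\<^sup>2" using pi_squared_bounds by (simp add: power_mult_distrib)
    then have "9 / (real r)\<^sup>2 \<le> \<theta>\<^sup>2" using r by (simp add: field_simps)
    then show ?thesis using one_minus_cos_ge[OF assms(2)] by simp
  qed
  also have "\<dots> \<le> (1 - cos (real r * \<theta>)) + (1 - cos (real (r - 1) * \<theta>))"
  proof -
    have "real r * \<theta> - real (r - 1) * \<theta> = \<theta>" using r by (simp add: of_nat_diff algebra_simps)
    then show ?thesis using one_minus_cos_diff_le[of "real r * \<theta>" "real (r - 1) * \<theta>"] by simp
  qed
  finally have "?w * (3 / 8 / (real r)\<^sup>2) \<le> ?w * ((1 - cos (real r * \<theta>)) + (1 - cos (real (r - 1) * \<theta>)))"
    by (rule mult_left_mono[OF _ w0])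
  also have "\<dots> = ?w * (1 - cos (real r * \<theta>)) + ?w * (1 - cos (real (r - 1) * \<theta>))"
    by (rule distrib_left)
  also have "\<dots> \<le> f r + f (r - 1)"
    unfolding f_def using x1 r2
    by (intro add_mono mult_right_mono frac_le power_increasing) auto
  also have "\<dots> = sum f {r - 1, r}" using r2 by simp
  also have "\<dots> \<le> (\<Sum>j=1..r. f j)"
    by (rule sum_mono2) (use r2 f0 in auto)
  finally have *: "?w * (3 / 8 / (real r)\<^sup>2) \<le> - Re (saddle_phase r n x \<theta>)"
    by (simp add: Re_saddle_phase f_def)
  have "real n * t / 3 \<le> x ^ (r - 1)"
  proof -
    have "x ^ (r - 1) = x ^ r * t" using r x_pos t by (cases r) (auto simp: x_def)
    then show ?thesis using mult_right_mono[OF x_power_r_ge, of t] t by simp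
  qed
  then have "real n * t / (9 * real r ^ 3) \<le> x ^ (r - 1) / 3 / real r ^ 3"
    using r by (simp add: field_simps)
  also have "\<dots> \<le> ?w * (3 / 8 / (real r)\<^sup>2)"
    using x_pos r by (simp add: eval_nat_numeral field_simps)
  finally show "Re (saddle_phase r n x \<theta>) \<le> - (real n * t / (9 * real r ^ 3))" using * by linarith
qed

end

context near_saddle
begin

text \<open>
  One bound for all real \<open>\<theta>\<close>, so that it can be integrated over the line: beyond \<open>\<bar>\<theta>\<bar> = pi / r\<close> the Gaussian is
  absorbed by the summand \<open>r * \<bar>\<theta>\<bar>\<close>, which is at least 1 there, and the integrand by the indicator term.
\<close>

lemma saddle_integrand_near_gaussian:
  assumes minor: "r \<ge> 2 \<Longrightarrow> exp (- (real n * t / (9 * real r ^ 3))) \<le> 1 / real n"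
  shows "cmod (indicator {-pi..pi} \<theta> *\<^sub>R exp (saddle_phase r n x \<theta>) - of_real (exp (- (real r * real n * \<theta>\<^sup>2 / 2))))
    \<le> (3 * \<bar>\<theta>\<bar> + real r * real n * t * \<theta>\<^sup>2 / 2 + (real r)\<^sup>2 * real n * \<bar>\<theta>\<bar> ^ 3 / 6 + real r * \<bar>\<theta>\<bar>)
        * exp (- (real r * real n * \<theta>\<^sup>2 / 36)) + indicator {-pi..pi} \<theta> * (1 / real n)"
proof -
  define Q where "Q = 3 * \<bar>\<theta>\<bar> + real r * real n * t * \<theta>\<^sup>2 / 2 + (real r)\<^sup>2 * real n * \<bar>\<theta>\<bar> ^ 3 / 6"
  define M where "M = - (real r * real n * \<theta>\<^sup>2 / 36)"
  let ?I = "indicator {-pi..pi} \<theta> :: real"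
  let ?F = "exp (saddle_phase r n x \<theta>)"
  let ?G = "of_real (exp (- (real r * real n * \<theta>\<^sup>2 / 2))) :: complex"
  have Q0: "0 \<le> Q" using t by (simp add: Q_def)
  have M2: "- (real r * real n * \<theta>\<^sup>2 / 2) \<le> M" by (simp add: M_def)
  have G_le: "cmod ?G \<le> real r * \<bar>\<theta>\<bar> * exp M" if "pi < real r * \<bar>\<theta>\<bar>"
  proof -
    have "cmod ?G \<le> 1 * exp M" using M2 by (simp add: norm_of_real)
    also have "\<dots> \<le> real r * \<bar>\<theta>\<bar> * exp M"
      by (rule mult_right_mono) (use that pi_gt3 in auto)
    finally show ?thesis .
  qed
  have Qe: "0 \<le> Q * exp M" "0 \<le> real r * \<bar>\<theta>\<bar> * exp M" using Q0 by auto
  consider (out) "pi < \<bar>\<theta>\<bar>" | (minor) "\<bar>\<theta>\<bar> \<le> pi" "pi < real r * \<bar>\<theta>\<bar>" | (major) "\<bar>\<theta>\<bar> \<le> pi" "real r * \<bar>\<theta>\<bar> \<le> pi"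
    by linarith
  then have "cmod (?I *\<^sub>R ?F - ?G) \<le> (Q + real r * \<bar>\<theta>\<bar>) * exp M + ?I * (1 / real n)"
  proof cases
    case out
    then have I: "?I = 0" by (auto simp: indicator_def)
    have "pi < real r * \<bar>\<theta>\<bar>" using out mult_right_mono[of 1 "real r" "\<bar>\<theta>\<bar>"] r by simp
    from G_le[OF this] show ?thesis using Qe unfolding I by (simp add: algebra_simps)
  next
    case minor
    then have I: "?I = 1" by (auto simp: indicator_def)
    have "cmod ?F \<le> exp (- (real n * t / (9 * real r ^ 3)))"
      using Re_saddle_phase_minor(2)[OF minor(2,1)] by (simp add: norm_exp_eq_Re)
    also have "\<dots> \<le> 1 / real n" by (rule assms) (rule Re_saddle_phase_minor(1)[OF minor(2,1)])
    finally have "cmod ?F \<le> 1 / real n" .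
    moreover have "cmod (?F - ?G) \<le> cmod ?F + cmod ?G" by (rule norm_triangle_ineq4)
    ultimately show ?thesis using G_le[OF minor(2)] Qe unfolding I
      by (simp add: algebra_simps del: norm_of_real)
  next
    case major
    then have I: "?I = 1" by (auto simp: indicator_def)
    have "cmod (?F - exp (of_real (- (real r * real n * \<theta>\<^sup>2 / 2)))) \<le>
       exp M * cmod (saddle_phase r n x \<theta> - of_real (- (real r * real n * \<theta>\<^sup>2 / 2)))"
      by (rule cmod_exp_diff_le) (use Re_saddle_phase_major[OF major(2)] M2 in \<open>auto simp: M_def\<close>)
    also have "\<dots> \<le> exp M * Q"
      unfolding Q_def by (rule mult_left_mono[OF saddle_phase_near_gaussian]) simp
    finally have "cmod (?F - ?G) \<le> exp M * Q" by (simp only: exp_of_real)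
    moreover have "(Q + real r * \<bar>\<theta>\<bar>) * exp M + 1 * (1 / real n) = exp M * Q + (real r * \<bar>\<theta>\<bar> * exp M + 1 / real n)"
      by (simp add: algebra_simps)
    moreover have "0 \<le> real r * \<bar>\<theta>\<bar> * exp M + 1 / real n" using Qe by simp
    ultimately show ?thesis unfolding I scaleR_one by linarith
  qed
  then show ?thesis by (simp add: Q_def M_def)
qed

text \<open>
  The majorant is integrated by the absolute moments of the normal distribution whose variance is
  \<open>18 / (r * n)\<close>. Relative to \<open>1 / sqrt (r * n)\<close>, drift, cubic remainder and Gaussian tail each contribute
  \<open>O(sqrt (r / n))\<close>, and so does the indicator term; the error in the variance contributes \<open>O(t)\<close>.
\<close>

lemma saddle_integral:
  assumes minor: "r \<ge> 2 \<Longrightarrow> exp (- (real n * t / (9 * real r ^ 3))) \<le> 1 / real n"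
  shows "cmod (integral {-pi..pi} (\<lambda>\<theta>. exp (saddle_phase r n x \<theta>)) - of_real (sqrt (2 * pi / (real r * real n))))
    \<le> sqrt (2 * pi / (real r * real n)) * (200 * (t + sqrt (real r / real n)))"
proof -
  define v where "v = 1 / sqrt (real r * real n)"
  define w where "w = sqrt (real r / real n)"
  \<comment> \<open>\<open>exp (- (\<theta>\<^sup>2 / (2 * \<sigma>\<^sup>2)))\<close> is the factor \<open>exp (- (r * n * \<theta>\<^sup>2 / 36))\<close> of the majorant\<close>
  define \<sigma> where "\<sigma> = sqrt 18 * v"
  define q where "q = sqrt (2 / pi)"
  let ?e = "\<lambda>\<theta>::real. exp (- (real r * real n * \<theta>\<^sup>2 / 36))"
  let ?F = "\<lambda>\<theta>. indicator {-pi..pi} \<theta> *\<^sub>R exp (saddle_phase r n x \<theta>)"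
  let ?G = "\<lambda>\<theta>::real. of_real (exp (- (real r * real n * \<theta>\<^sup>2 / 2))) :: complex"
  let ?M = "\<lambda>\<theta>. (3 * \<bar>\<theta>\<bar> + real r * real n * t * \<theta>\<^sup>2 / 2 + (real r)\<^sup>2 * real n * \<bar>\<theta>\<bar> ^ 3 / 6 + real r * \<bar>\<theta>\<bar>)
        * ?e \<theta> + indicator {-pi..pi} \<theta> * (1 / real n)"
  have rn: "real r * real n > 0" using r n by simp
  have v0: "v > 0" using rn by (simp add: v_def)
  have v2: "v\<^sup>2 = 1 / (real r * real n)" using rn by (simp add: v_def power_divide)
  have \<sigma>0: "\<sigma> > 0" using v0 by (simp add: \<sigma>_def)
  have \<sigma>2: "\<sigma>\<^sup>2 = 18 / (real r * real n)" by (simp add: \<sigma>_def power_mult_distrib v2)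
  have g: "sqrt (2 * pi / (real r * real n)) = sqrt (2 * pi) * v"
    by (simp add: v_def real_sqrt_divide)
  have w_v: "w = real r * v"
  proof -
    have "real r / real n = (real r)\<^sup>2 / (real r * real n)" using r by (simp add: power2_eq_square)
    then show ?thesis by (simp add: w_def v_def real_sqrt_divide)
  qed
  have e_nd: "?e \<theta> = sqrt (2 * pi) * \<sigma> * normal_density 0 \<sigma> \<theta>" for \<theta>
  proof -
    have a: "sqrt (2 * pi * \<sigma>\<^sup>2) = sqrt (2 * pi) * \<sigma>" using \<sigma>0 by (simp add: real_sqrt_mult)
    have b: "- (\<theta> - 0)\<^sup>2 / (2 * \<sigma>\<^sup>2) = - (real r * real n * \<theta>\<^sup>2 / 36)" unfolding \<sigma>2 by simp
    show ?thesis unfolding normal_density_def a b using \<sigma>0 by simp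
  qed
  have m1: "has_bochner_integral lborel (\<lambda>\<theta>. normal_density 0 \<sigma> \<theta> * \<bar>\<theta>\<bar>) (\<sigma> * q)"
    using normal_moment_abs_odd[OF \<sigma>0, of 0 0] by (simp add: q_def)
  have m2: "has_bochner_integral lborel (\<lambda>\<theta>. normal_density 0 \<sigma> \<theta> * \<theta>\<^sup>2) (\<sigma>\<^sup>2)"
    using normal_moment_even[OF \<sigma>0, of 0 1] by (simp add: fact_numeral)
  have m3: "has_bochner_integral lborel (\<lambda>\<theta>. normal_density 0 \<sigma> \<theta> * \<bar>\<theta>\<bar> ^ 3) (2 * \<sigma> ^ 3 * q)"
    using normal_moment_abs_odd[OF \<sigma>0, of 0 1] by (simp add: q_def numeral_3_eq_3)
  have m0: "has_bochner_integral lborel (\<lambda>\<theta>. indicator {-pi..pi} \<theta> * (1 / real n)) (2 * pi * (1 / real n))"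
    by (rule has_bochner_integral_mult_left) (use has_bochner_integral_real_indicator[of "{-pi..pi}" lborel] in auto)
  define V where "V = sqrt (2 * pi) * \<sigma> * ((3 + real r) * (\<sigma> * q) + real r * real n * t / 2 * \<sigma>\<^sup>2
      + (real r)\<^sup>2 * real n / 6 * (2 * \<sigma> ^ 3 * q)) + 2 * pi * (1 / real n)"
  have M: "has_bochner_integral lborel ?M V"
  proof -
    have "has_bochner_integral lborel (\<lambda>\<theta>. sqrt (2 * pi) * \<sigma> * ((3 + real r) * (normal_density 0 \<sigma> \<theta> * \<bar>\<theta>\<bar>)
       + real r * real n * t / 2 * (normal_density 0 \<sigma> \<theta> * \<theta>\<^sup>2)
       + (real r)\<^sup>2 * real n / 6 * (normal_density 0 \<sigma> \<theta> * \<bar>\<theta>\<bar> ^ 3)) + indicator {-pi..pi} \<theta> * (1 / real n)) V"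
      unfolding V_def
      by (intro has_bochner_integral_add has_bochner_integral_mult_right m0 m1 m2 m3)
    also have "(\<lambda>\<theta>. sqrt (2 * pi) * \<sigma> * ((3 + real r) * (normal_density 0 \<sigma> \<theta> * \<bar>\<theta>\<bar>)
       + real r * real n * t / 2 * (normal_density 0 \<sigma> \<theta> * \<theta>\<^sup>2)
       + (real r)\<^sup>2 * real n / 6 * (normal_density 0 \<sigma> \<theta> * \<bar>\<theta>\<bar> ^ 3)) + indicator {-pi..pi} \<theta> * (1 / real n)) = ?M"
      unfolding e_nd by (simp add: fun_eq_iff algebra_simps)
    finally show ?thesis .
  qed
  have G: "has_bochner_integral lborel ?G (of_real (sqrt (2 * pi) * v))"
  proof -
    have "exp (- (real r * real n * \<theta>\<^sup>2 / 2)) = sqrt (2 * pi) * v * normal_density 0 v \<theta>" for \<theta>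
    proof -
      have a: "sqrt (2 * pi * v\<^sup>2) = sqrt (2 * pi) * v" using v0 by (simp add: real_sqrt_mult)
      have b: "- (\<theta> - 0)\<^sup>2 / (2 * v\<^sup>2) = - (real r * real n * \<theta>\<^sup>2 / 2)" unfolding v2 by simp
      show ?thesis unfolding normal_density_def a b using v0 by simp
    qed
    moreover have "has_bochner_integral lborel (normal_density 0 v) 1"
      using normal_moment_even[OF v0, of 0 0] by simp
    then have "has_bochner_integral lborel (\<lambda>\<theta>. sqrt (2 * pi) * v * normal_density 0 v \<theta>) (sqrt (2 * pi) * v * 1)"
      by (rule has_bochner_integral_mult_right)
    ultimately show ?thesis using has_bochner_integral_of_real by fastforce
  qed
  have cont: "continuous_on {-pi..pi} (\<lambda>\<theta>. exp (saddle_phase r n x \<theta>))"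
    unfolding saddle_phase_eq by (intro continuous_intros)
  have F_int: "integrable lborel ?F"
    using borel_integrable_atLeastAtMost'[OF cont] by (simp add: set_integrable_def)
  have F_eq: "integral\<^sup>L lborel ?F = integral {-pi..pi} (\<lambda>\<theta>. exp (saddle_phase r n x \<theta>))"
    using set_borel_integral_eq_integral(2)[OF borel_integrable_atLeastAtMost'[OF cont]]
    by (simp add: set_lebesgue_integral_def)
  have "cmod (\<integral>\<theta>. ?F \<theta> - ?G \<theta> \<partial>lborel) \<le> (\<integral>\<theta>. ?M \<theta> \<partial>lborel)"
  proof (rule Bochner_Integration.integral_norm_bound_integral)
    show "integrable lborel (\<lambda>\<theta>. ?F \<theta> - ?G \<theta>)"
      using F_int G by (intro Bochner_Integration.integrable_diff) (auto simp: has_bochner_integral_iff)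
    show "integrable lborel ?M" using M by (simp add: has_bochner_integral_iff)
    show "cmod (?F \<theta> - ?G \<theta>) \<le> ?M \<theta>" for \<theta>
      by (rule saddle_integrand_near_gaussian[OF minor])
  qed
  also have "(\<integral>\<theta>. ?M \<theta> \<partial>lborel) = V" using M by (rule has_bochner_integral_integral_eq)
  also have "(\<integral>\<theta>. ?F \<theta> - ?G \<theta> \<partial>lborel) = integral {-pi..pi} (\<lambda>\<theta>. exp (saddle_phase r n x \<theta>)) - of_real (sqrt (2 * pi) * v)"
    using F_int G by (subst Bochner_Integration.integral_diff) (auto simp: has_bochner_integral_iff F_eq)
  finally have "cmod (integral {-pi..pi} (\<lambda>\<theta>. exp (saddle_phase r n x \<theta>)) - of_real (sqrt (2 * pi) * v)) \<le> V" .
  also have "V \<le> sqrt (2 * pi) * v * (200 * (t + w))"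
  proof -
    have q: "0 \<le> q" "q \<le> 1" using pi_gt3 by (auto simp: q_def real_sqrt_le_1_iff)
    have w0: "0 \<le> w" by (simp add: w_def)
    have n1: "1 / real n = v * w" using v2 r n by (simp add: w_v power2_eq_square field_simps)
    have s18: "sqrt 18 * sqrt 18 = (18::real)" by simp
    have s: "sqrt 18 \<le> (5::real)" by (rule real_le_lsqrt) auto
    have p: "sqrt (2 * pi) \<le> 3" by (rule real_le_lsqrt) (use pi_less_4 in auto)
    define B where "B = (3 + real r) * (\<sigma> * q) + real r * real n * t / 2 * \<sigma>\<^sup>2
      + (real r)\<^sup>2 * real n / 6 * (2 * \<sigma> ^ 3 * q)"
    have V: "V = sqrt (2 * pi) * v * (sqrt 18 * B + sqrt (2 * pi) * w)"
    proof -
      have "2 * pi * (v * w) = sqrt (2 * pi) * sqrt (2 * pi) * (v * w)" by simp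
      also have "\<dots> = sqrt (2 * pi) * v * (sqrt (2 * pi) * w)" by (simp only: mult_ac)
      finally have "2 * pi * (v * w) = sqrt (2 * pi) * v * (sqrt (2 * pi) * w)" .
      then show ?thesis unfolding V_def n1 B_def[symmetric] by (simp add: \<sigma>_def distrib_left)
    qed
    have B1: "(3 + real r) * (\<sigma> * q) \<le> sqrt 18 * (4 * w)"
    proof -
      have "(3 + real r) * (\<sigma> * q) \<le> (4 * real r) * (\<sigma> * 1)"
        by (rule mult_mono) (use r \<sigma>0 q in auto)
      then show ?thesis by (simp add: \<sigma>_def w_v algebra_simps)
    qed
    have B2: "real r * real n * t / 2 * \<sigma>\<^sup>2 = 9 * t"
      using r n by (simp add: \<sigma>2)
    have B3: "(real r)\<^sup>2 * real n / 6 * (2 * \<sigma> ^ 3 * q) \<le> sqrt 18 * (6 * w)"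
    proof -
      have "\<sigma> ^ 3 = \<sigma> * \<sigma>\<^sup>2" by (simp add: eval_nat_numeral)
      then have "(real r)\<^sup>2 * real n / 6 * (2 * \<sigma> ^ 3 * q) = sqrt 18 * (6 * w) * q"
        unfolding \<sigma>2 using r n by (simp add: \<sigma>_def w_v power2_eq_square)
      also have "\<dots> \<le> sqrt 18 * (6 * w) * 1" by (rule mult_left_mono) (use q w0 in auto)
      finally show ?thesis by simp
    qed
    have "sqrt 18 * B \<le> sqrt 18 * (sqrt 18 * (4 * w) + 9 * t + sqrt 18 * (6 * w))"
      unfolding B_def B2 by (intro mult_left_mono add_mono B1 B3 order_refl) simp
    also have "\<dots> = 180 * w + sqrt 18 * (9 * t)" by (simp add: distrib_left mult.assoc[symmetric])
    also have "sqrt 18 * (9 * t) \<le> 5 * (9 * t)" by (rule mult_right_mono[OF s]) (use t in auto)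
    finally have "sqrt 18 * B \<le> 180 * w + 45 * t" by simp
    moreover have "sqrt (2 * pi) * w \<le> 3 * w" by (rule mult_right_mono[OF p w0])
    ultimately have "sqrt 18 * B + sqrt (2 * pi) * w \<le> (180 * w + 45 * t) + 3 * w" by (rule add_mono)
    also have "\<dots> \<le> 200 * (t + w)" unfolding distrib_left using t w0 by linarith
    finally have "sqrt 18 * B + sqrt (2 * pi) * w \<le> 200 * (t + w)" .
    then show ?thesis unfolding V by (rule mult_left_mono) (use v0 in simp)
  qed
  finally show ?thesis by (simp add: g w_def)
qed

end

lemma (in near_saddle) nu_near_saddle:
  assumes minor: "r \<ge> 2 \<Longrightarrow> exp (- (real n * t / (9 * real r ^ 3))) \<le> 1 / real n"
  defines "P \<equiv> exp ((\<Sum>j=1..r. x ^ j / real j) + real n * ln t) / sqrt (2 * pi * real n * real r)"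
  shows "\<bar>nu n r / P - 1\<bar> \<le> 200 * (t + sqrt (real r / real n))"
proof -
  let ?J = "integral {-pi..pi} (\<lambda>\<theta>. exp (saddle_phase r n x \<theta>))"
  let ?c = "exp (cycle_poly r x) / (2 * pi * x ^ n)"
  let ?g = "sqrt (2 * pi / (real r * real n))"
  have c0: "?c > 0" using x_pos by simp
  have P0: "P > 0" using r n by (simp add: P_def)
  have "(\<lambda>\<theta>. exp (cycle_poly r (of_real x * cis \<theta>)) * cis (- (real n * \<theta>))) =
     (\<lambda>\<theta>. of_real (exp (cycle_poly r x)) * exp (saddle_phase r n x \<theta>))"
  proof
    fix \<theta> :: real
    let ?h = "complex_of_real (cycle_poly r x)"
    have "exp (saddle_phase r n x \<theta>) = exp (cycle_poly r (of_real x * cis \<theta>)) * exp (- ?h) * exp (- (\<i> * of_real (real n * \<theta>)))"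
      by (simp add: saddle_phase_def flip: exp_add)
    moreover have "cis (- (real n * \<theta>)) = exp (- (\<i> * of_real (real n * \<theta>)))"
      by (simp add: cis_conv_exp)
    moreover have "exp ?h * exp (- ?h) = 1" by (rule exp_minus_inverse)
    ultimately show "exp (cycle_poly r (of_real x * cis \<theta>)) * cis (- (real n * \<theta>)) =
        of_real (exp (cycle_poly r x)) * exp (saddle_phase r n x \<theta>)"
      by (simp add: exp_of_real[symmetric])
  qed
  then have "egf_coeff r n = of_real (1 / (2 * pi * x ^ n)) * (of_real (exp (cycle_poly r x)) * ?J)"
    using egf_coeff_integral[OF x_pos, of r n] by simp
  then have nu: "complex_of_real (nu n r) = of_real ?c * ?J"
    by (simp add: nu_eq_egf_coeff)
  have P: "P = ?c * ?g"
  proof -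
    have "exp ((\<Sum>j=1..r. x ^ j / real j) + real n * ln t) = exp (cycle_poly r x) * t ^ n"
      using t by (simp add: exp_add cycle_poly_def exp_of_nat_mult)
    moreover have "t ^ n = 1 / x ^ n" using t by (simp add: x_def power_divide)
    moreover have "?g / (2 * pi) = 1 / sqrt (2 * pi * real n * real r)"
    proof -
      have "?g = sqrt (2 * pi) * sqrt (2 * pi) / sqrt (2 * pi * real n * real r)"
        using r n by (simp add: real_sqrt_divide real_sqrt_mult)
      then show ?thesis by simp
    qed
    ultimately show ?thesis unfolding P_def by (simp add: field_simps)
  qed
  have "\<bar>nu n r - P\<bar> = cmod (of_real ?c * ?J - of_real (?c * ?g))"
    unfolding nu[symmetric] P by (metis norm_of_real of_real_diff)
  also have "\<dots> = ?c * cmod (?J - of_real ?g)"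
    using c0 by (simp only: of_real_mult right_diff_distrib[symmetric] norm_mult norm_of_real abs_of_pos)
  also have "\<dots> \<le> ?c * (?g * (200 * (t + sqrt (real r / real n))))"
    by (rule mult_left_mono[OF saddle_integral[OF minor]]) (use c0 in auto)
  also have "\<dots> = P * (200 * (t + sqrt (real r / real n)))" unfolding P by simp
  finally have "\<bar>nu n r - P\<bar> / P \<le> 200 * (t + sqrt (real r / real n))"
    using P0 by (simp add: field_simps)
  moreover have "\<bar>nu n r / P - 1\<bar> = \<bar>nu n r - P\<bar> / P"
    using P0 by (simp add: field_simps abs_divide)
  ultimately show ?thesis by simp
qed

section \<open>An instance of Lagrange inversion\<close>

text \<open>
  The coefficients of \<open>(1 - t) powr (- s)\<close> as a power series in \<open>t\<close>.
\<close>

definition negbin :: "real \<Rightarrow> nat \<Rightarrow> real" where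
  "negbin s j = pochhammer s j / fact j"

lemma negbin_0 [simp]: "negbin s 0 = 1"
  by (simp add: negbin_def)

lemma negbin_Suc: "negbin s (Suc j) = negbin s j * (s + j) / (j + 1)"
  by (simp add: negbin_def pochhammer_Suc field_simps)

lemma negbin_add_one_Suc: "negbin (s + 1) (Suc j) = negbin (s + 1) j + negbin s (Suc j)"
proof -
  have "pochhammer s (Suc j) = s * pochhammer (s + 1) j"
    by (rule pochhammer_rec)
  moreover have "pochhammer (s + 1) (Suc j) = pochhammer (s + 1) j * (s + 1 + real j)"
    by (rule pochhammer_Suc)
  moreover have "fact (Suc j) = (1 + real j) * fact j" by simp
  ultimately show ?thesis
    unfolding negbin_def by (simp only:) (simp add: divide_simps, simp add: algebra_simps)
qed

lemma sum_negbin: "(\<Sum>l\<le>j. negbin s l) = negbin (s + 1) j"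
  by (induction j) (simp_all add: negbin_add_one_Suc)

lemma negbin_nonneg: "s \<ge> 0 \<Longrightarrow> negbin s j \<ge> 0"
  by (auto simp: negbin_def pochhammer_prod intro!: divide_nonneg_pos prod_nonneg)

lemma negbin_le:
  assumes "0 \<le> s" "s \<le> 1" "j \<ge> 1"
  shows "negbin s j \<le> s"
  using assms(3)
proof (induction j rule: nat_induct_at_least)
  case base
  then show ?case by (simp add: negbin_def)
next
  case (Suc j)
  have "negbin s (Suc j) = negbin s j * ((s + j) / (j + 1))" by (simp add: negbin_Suc)
  also have "\<dots> \<le> negbin s j * 1"
    by (rule mult_left_mono) (use assms in \<open>auto simp: negbin_nonneg\<close>)
  finally show ?case using Suc by simp
qed

lemma negbin_sums:
  assumes "\<bar>t\<bar> < 1"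
  shows "(\<lambda>j. negbin s j * t ^ j) sums (1 - t) powr (- s)"
proof -
  have "(\<lambda>j. (- s gchoose j) * (- t) ^ j) sums (1 + (- t)) powr (- s)"
    by (rule gen_binomial_real) (use assms in auto)
  moreover have "(- s gchoose j) * (- t) ^ j = negbin s j * t ^ j" for j
    by (subst power_minus) (simp add: gbinomial_pochhammer negbin_def flip: power_mult_distrib)
  ultimately show ?thesis by simp
qed

text \<open>
  Up to sign this is the \<open>m\<close>-th finite difference at 0 of a polynomial of degree at most \<open>N < m\<close>. In the
  induction step, \<open>k * (m choose k) = m * (m - 1 choose (k - 1))\<close> lowers both \<open>m\<close> and the number of factors.
\<close>

lemma alternating_sum_affine_prod:
  fixes \<alpha> :: real and \<beta> :: "nat \<Rightarrow> real"
  assumes "N < m"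
  shows "(\<Sum>k\<le>m. (-1) ^ k * real (m choose k) * (\<Prod>l<N. \<alpha> * real k + \<beta> l)) = 0"
  using assms
proof (induction N arbitrary: m \<beta>)
  case 0
  then show ?case using choose_alternating_sum[of m, where 'a = real] by simp
next
  case (Suc N)
  then obtain m' where m: "m = Suc m'" by (cases m) auto
  let ?P = "\<lambda>k. \<Prod>l<N. \<alpha> * real k + \<beta> l"
  have "(\<Sum>k\<le>m. (-1) ^ k * real (m choose k) * (real k * ?P k)) =
        (\<Sum>k\<le>m'. (-1) ^ Suc k * real (m choose Suc k) * (real (Suc k) * ?P (Suc k)))"
    unfolding m by (subst sum.atMost_Suc_shift) simp
  also have "\<dots> = (\<Sum>k\<le>m'. - real m * ((-1) ^ k * real (m' choose k) * (\<Prod>l<N. \<alpha> * real k + (\<alpha> + \<beta> l))))"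
  proof (rule sum.cong[OF refl])
    fix k
    have "real (m choose Suc k) * real (Suc k) = real m * real (m' choose k)"
      unfolding m using Suc_times_binomial_eq[of m' k] by (metis mult.commute of_nat_mult)
    moreover have "?P (Suc k) = (\<Prod>l<N. \<alpha> * real k + (\<alpha> + \<beta> l))"
      by (simp add: algebra_simps)
    moreover have "(-1) ^ Suc k * real (m choose Suc k) * (real (Suc k) * ?P (Suc k)) =
        - ((-1) ^ k * (real (m choose Suc k) * real (Suc k)) * ?P (Suc k))"
      by (simp del: of_nat_Suc)
    ultimately show "(-1) ^ Suc k * real (m choose Suc k) * (real (Suc k) * ?P (Suc k)) =
        - real m * ((-1) ^ k * real (m' choose k) * (\<Prod>l<N. \<alpha> * real k + (\<alpha> + \<beta> l)))"
      by (simp only:) simp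
  qed
  also have "\<dots> = 0"
    unfolding sum_distrib_left[symmetric] using Suc.IH[of m' "\<lambda>l. \<alpha> + \<beta> l"] Suc.prems m by simp
  finally have *: "(\<Sum>k\<le>m. (-1) ^ k * real (m choose k) * (real k * ?P k)) = 0" .
  have "(\<Sum>k\<le>m. (-1) ^ k * real (m choose k) * (\<Prod>l<Suc N. \<alpha> * real k + \<beta> l)) =
     \<alpha> * (\<Sum>k\<le>m. (-1) ^ k * real (m choose k) * (real k * ?P k)) +
     \<beta> N * (\<Sum>k\<le>m. (-1) ^ k * real (m choose k) * ?P k)"
    unfolding sum_distrib_left sum.distrib[symmetric] by (rule sum.cong) (simp_all add: algebra_simps)
  also have "\<dots> = 0" using * Suc.IH[of m \<beta>] Suc.prems by simp
  finally show ?case .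
qed

text \<open>
  The factors \<open>y + i\<close> with \<open>0 \<le> i < k\<close> and, up to sign, those with \<open>k - m < i \<le> 0\<close> form one ascending run
  in which \<open>y\<close> occurs twice.
\<close>

lemma pochhammer_mult_pochhammer_minus:
  fixes y :: real
  assumes "k \<ge> 1" "k \<le> m"
  shows "pochhammer y k * pochhammer (- y) (m - k) =
    (-1) ^ (m - k) * y * pochhammer (y + real k - real m + 1) (m - 1)"
proof (cases "k = m")
  case True
  with assms obtain m' where "m = Suc m'" by (cases m) auto
  with True show ?thesis by (simp add: pochhammer_rec)
next
  case False
  define j where "j = m - k - 1"
  have m: "m = Suc (j + k)" "m - k = Suc j" using False assms by (auto simp: j_def)
  have "pochhammer (- y) (Suc j) = - y * pochhammer (- (y - 1)) j"
    by (simp add: pochhammer_rec)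
  also have "pochhammer (- (y - 1)) j = (-1) ^ j * pochhammer (y - real j) j"
    by (subst pochhammer_minus) (simp add: algebra_simps)
  finally have "pochhammer y k * pochhammer (- y) (m - k) =
      (-1) ^ (m - k) * y * (pochhammer (y - real j) j * pochhammer y k)"
    by (simp add: m)
  also have "pochhammer (y - real j) j * pochhammer y k = pochhammer (y - real j) (j + k)"
    by (simp add: pochhammer_product')
  finally show ?thesis by (simp add: m)
qed

text \<open>
  Lagrange inversion for \<open>u = t * (1 - t) powr x\<close>: if \<open>a\<^sub>k = negbin (k * x) k / k\<close>, then
  \<open>(\<Sum>k. a\<^sub>k * u ^ k) = - x * ln (1 - t)\<close>, and the identity compares the coefficients of \<open>t ^ m\<close>. As
  functions of \<open>k\<close>, the summands are \<open>(-1) ^ k * (m choose k)\<close> times a polynomial of degree \<open>m - 1\<close>, so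
  the sum over \<open>0 \<le> k \<le> m\<close> vanishes and the sum from 1 is minus the term at \<open>k = 0\<close>.
\<close>

lemma sum_negbin_mult_negbin:
  fixes x :: real
  assumes m: "m \<ge> 1"
  shows "(\<Sum>k=1..m. negbin (real k * x) k / real k * negbin (- (real k * x)) (m - k)) = x / real m"
proof -
  let ?q = "\<lambda>k. pochhammer (real k * (x + 1) - real m + 1) (m - 1)"
  have "?q k = (\<Prod>i<m - 1. (x + 1) * real k + (1 - real m + real i))" for k
    by (simp add: pochhammer_prod atLeast0LessThan algebra_simps)
  then have alt: "(\<Sum>k\<le>m. (-1) ^ k * real (m choose k) * ?q k) = 0"
    using alternating_sum_affine_prod[of "m - 1" m "x + 1" "\<lambda>i. 1 - real m + real i"] m by simp
  have q0: "?q 0 = (-1) ^ (m - 1) * fact (m - 1)"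
    using pochhammer_minus[of "real (m - 1)" "m - 1"] m
    by (simp add: of_nat_diff pochhammer_fact algebra_simps)
  have "(\<Sum>k=1..m. negbin (real k * x) k / real k * negbin (- (real k * x)) (m - k)) =
        (\<Sum>k=1..m. (-1) ^ m * x / fact m * ((-1) ^ k * real (m choose k) * ?q k))"
  proof (rule sum.cong[OF refl])
    fix k assume k: "k \<in> {1..m}"
    have "negbin (real k * x) k / real k * negbin (- (real k * x)) (m - k) =
      pochhammer (real k * x) k * pochhammer (- (real k * x)) (m - k) / (real k * fact k * fact (m - k))"
      by (simp add: negbin_def)
    also have "\<dots> = (-1) ^ (m - k) * (real k * x) * ?q k / (real k * fact k * fact (m - k))"
      using pochhammer_mult_pochhammer_minus[of k m "real k * x"] k by (simp add: algebra_simps)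
    also have "\<dots> = (-1) ^ (m - k) * x * ?q k / (fact k * fact (m - k))"
      using k by simp
    also have "(-1) ^ (m - k) = (-1) ^ m * (-1 :: real) ^ k"
      using k by (auto simp: minus_one_power_iff)
    also have "(-1) ^ m * (-1 :: real) ^ k * x * ?q k / (fact k * fact (m - k)) = 
        (-1) ^ m * x / fact m * ((-1) ^ k * real (m choose k) * ?q k)"
      using k by (simp add: binomial_fact)
    finally show "negbin (real k * x) k / real k * negbin (- (real k * x)) (m - k) =
      (-1) ^ m * x / fact m * ((-1) ^ k * real (m choose k) * ?q k)" .
  qed
  also have "\<dots> = (-1) ^ m * x / fact m * (\<Sum>k=1..m. (-1) ^ k * real (m choose k) * ?q k)"
    by (simp add: sum_distrib_left)
  also have "(\<Sum>k=1..m. (-1) ^ k * real (m choose k) * ?q k) = - ?q 0"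
  proof -
    have "{..m} = insert 0 {1..m}" by auto
    then show ?thesis using alt by simp
  qed
  also have "(-1) ^ m * x / fact m * - ?q 0 = x / real m"
  proof -
    have "fact m = real m * fact (m - 1)" using m by (subst fact_reduce) auto
    moreover have "(-1) ^ m * (- ((-1 :: real) ^ (m - 1))) = 1" using m by (cases m) (simp_all flip: power_mult_distrib)
    ultimately show ?thesis unfolding q0 using m
      by (metis (no_types, opaque_lifting) fact_nonzero mult.commute mult.left_commute mult_minus_left mult_1 nonzero_mult_divide_mult_cancel_right times_divide_eq_left)
  qed
  finally show ?thesis .
qed

lemma sum_triangle_swap:
  fixes f :: "nat \<Rightarrow> nat \<Rightarrow> real"
  shows "(\<Sum>k=1..m. \<Sum>i=k..m. f k i) = (\<Sum>i=1..m. \<Sum>k=1..i. f k i)"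
  by (simp add: sum.Sigma) (rule sum.reindex_bij_witness[of _ "\<lambda>(i,k). (k,i)" "\<lambda>(k,i). (i,k)"]; auto)

text \<open>
  The same identity after multiplication of both sides by the power series with coefficients \<open>w\<close>.
\<close>

lemma sum_negbin_conv:
  fixes w :: "nat \<Rightarrow> real"
  shows "(\<Sum>k=1..m. negbin (real k * x) k / real k * (\<Sum>l\<le>m - k. negbin (- (real k * x)) l * w (m - k - l))) =
         (\<Sum>i=1..m. x / real i * w (m - i))"
proof -
  have "(\<Sum>k=1..m. negbin (real k * x) k / real k * (\<Sum>l\<le>m - k. negbin (- (real k * x)) l * w (m - k - l))) =
     (\<Sum>k=1..m. \<Sum>i=k..m. negbin (real k * x) k / real k * negbin (- (real k * x)) (i - k) * w (m - i))"
  proof (rule sum.cong[OF refl])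
    fix k assume k: "k \<in> {1..m}"
    show "negbin (real k * x) k / real k * (\<Sum>l\<le>m - k. negbin (- (real k * x)) l * w (m - k - l)) =
      (\<Sum>i=k..m. negbin (real k * x) k / real k * negbin (- (real k * x)) (i - k) * w (m - i))"
      unfolding sum_distrib_left
      by (rule sum.reindex_bij_witness[of _ "\<lambda>i. i - k" "\<lambda>l. l + k"]) (use k in \<open>auto simp: add.commute\<close>)
  qed
  also have "\<dots> = (\<Sum>i=1..m. \<Sum>k=1..i. negbin (real k * x) k / real k * negbin (- (real k * x)) (i - k) * w (m - i))"
    by (rule sum_triangle_swap)
  also have "\<dots> = (\<Sum>i=1..m. x / real i * w (m - i))"
    unfolding sum_distrib_right[symmetric]
    by (rule sum.cong[OF refl], subst sum_negbin_mult_negbin) auto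
  finally show ?thesis .
qed

text \<open>
  The weights \<open>1 - x * i\<close> are the coefficients of \<open>1 / (1 - t) - x * t / (1 - t) ^ 2\<close>, which arises from the
  logarithmic derivative \<open>1 / t - x / (1 - t)\<close> of \<open>u\<close> upon multiplication by \<open>t / (1 - t)\<close>. So this is
  the coefficient form of a derivative of a power of \<open>u\<close>.
\<close>

lemma sum_negbin_weighted:
  "(1 - s) * (\<Sum>l\<le>j. negbin (- s) l * (1 - x * real (j - l))) = (1 - s - x * real j) * negbin (1 - s) j"
proof -
  have *: "(\<Sum>l\<le>j. negbin (- s) l * real (j - l)) * (1 - s) = real j * negbin (1 - s) j"
  proof (induction j)
    case (Suc j)
    have "(\<Sum>l\<le>Suc j. negbin (- s) l * real (Suc j - l)) =
          (\<Sum>l\<le>j. negbin (- s) l * real (j - l)) + (\<Sum>l\<le>j. negbin (- s) l)"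
      unfolding sum.atMost_Suc sum.distrib[symmetric]
      by (auto intro!: sum.cong simp: Suc_diff_le algebra_simps)
    also have "(\<Sum>l\<le>j. negbin (- s) l) = negbin (1 - s) j"
      using sum_negbin[of "- s" j] by simp
    finally show ?case using Suc negbin_Suc[of "1 - s" j] by (simp add: field_simps)
  qed simp
  have "(\<Sum>l\<le>j. negbin (- s) l * (1 - x * real (j - l))) =
     (\<Sum>l\<le>j. negbin (- s) l) - x * (\<Sum>l\<le>j. negbin (- s) l * real (j - l))"
    unfolding sum_distrib_left sum_subtractf[symmetric]
    by (rule sum.cong[OF refl]) (simp only: right_diff_distrib mult_1_right mult.left_commute)
  also have "(1 - s) * \<dots> = (1 - s) * (\<Sum>l\<le>j. negbin (- s) l) - x * (real j * negbin (1 - s) j)"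
    unfolding *[symmetric] by (simp add: algebra_simps)
  also have "(\<Sum>l\<le>j. negbin (- s) l) = negbin (1 - s) j"
    using sum_negbin[of "- s" j] by simp
  finally show ?thesis by (simp add: algebra_simps)
qed

lemma d_coeff_eq_negbin:
  assumes "1 \<le> k" "k < r"
  shows "d_coeff r k = real r / (real k * (real r - real k)) * negbin (real k / real r) k"
proof -
  define s where "s = real k / real r"
  have s: "s > 0" using assms by (simp add: s_def)
  have "s \<notin> \<int>\<^sub>\<le>\<^sub>0" using s by (auto elim!: nonpos_Ints_cases)
  have "Gamma s > 0" using s by (rule Gamma_real_pos)
  with \<open>s \<notin> \<int>\<^sub>\<le>\<^sub>0\<close> have "Gamma (real k + s) = pochhammer s k * Gamma s"
    using pochhammer_Gamma[of s k] by (simp add: add.commute)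
  moreover have "Gamma s \<noteq> 0" using \<open>Gamma s > 0\<close> by linarith
  moreover have "Gamma (1 + s) = s * Gamma s" using s by (subst add.commute, intro Gamma_plus1) (auto elim!: nonpos_Ints_cases)
  moreover have "Gamma (real k + 1) = fact k" by (metis Gamma_fact add.commute)
  ultimately have "d_coeff r k = 1 / ((real r - real k) * s) * negbin s k"
    using assms s by (simp add: d_coeff_def s_def[symmetric] negbin_def)
  also have "1 / ((real r - real k) * s) = real r / (real k * (real r - real k))"
    using assms by (simp add: s_def field_simps)
  finally show ?thesis by (simp add: s_def)
qed

text \<open>
  With \<open>n = 1 / (t ^ r * (1 - t))\<close>, the product of \<open>t ^ r\<close> and \<open>\<Sum>k=1..r - 1. d_coeff r k * n powr ((r - k) / r)\<close>
  is \<open>\<Sum>k=1..r - 1. d_coeff r k * t ^ k * (1 - t) powr (- (1 - k / r))\<close>; these are its coefficients in \<open>t\<close>.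
\<close>

definition d_sum_coeff :: "nat \<Rightarrow> nat \<Rightarrow> real" where
  "d_sum_coeff r m = (\<Sum>k=1..min m (r - 1). d_coeff r k * negbin (1 - real k / real r) (m - k))"

text \<open>
  Differentiation turns the factor \<open>1 / (r - k)\<close> of \<open>d_coeff r k\<close> into the coefficients to which the Lagrange
  identity applies; on the coefficient of \<open>t ^ m\<close> it acts as multiplication by \<open>1 - m / r\<close>, which can be
  divided out because \<open>m < r\<close>.
\<close>

lemma d_sum_coeff_less:
  assumes "m < r"
  shows "d_sum_coeff r m = (\<Sum>i=1..m. 1 / real i) / real r + 1 / (real r - real m) - 1 / real r"
proof -
  define x where "x = 1 / real r"
  have r: "real r > 0" "real r - real m > 0" using assms by auto
  have "(1 - x * real m) * d_sum_coeff r m =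
    (\<Sum>k=1..m. negbin (real k * x) k / real k * (\<Sum>l\<le>m - k. negbin (- (real k * x)) l * (1 - x * real (m - k - l))))"
    unfolding d_sum_coeff_def sum_distrib_left[of "1 - x * real m"]
  proof (rule sum.cong)
    show "{1..min m (r - 1)} = {1..m}" using assms by auto
    fix k assume "k \<in> {1..m}"
    then have k: "1 \<le> k" "k \<le> m" by auto
    then have s: "1 - real k * x > 0" using assms by (simp add: x_def)
    have xm: "1 - x * real m = 1 - real k * x - x * real (m - k)"
      using k by (simp add: of_nat_diff algebra_simps)
    have d: "d_coeff r k = negbin (real k * x) k / real k / (1 - real k * x)"
      using k assms by (simp add: d_coeff_eq_negbin x_def field_simps)
    have "(1 - x * real m) * (d_coeff r k * negbin (1 - real k / real r) (m - k)) =
      negbin (real k * x) k / real k / (1 - real k * x) * ((1 - x * real m) * negbin (1 - real k * x) (m - k))"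
      unfolding d by (simp add: x_def)
    also have "(1 - x * real m) * negbin (1 - real k * x) (m - k) =
      (1 - real k * x) * (\<Sum>l\<le>m - k. negbin (- (real k * x)) l * (1 - x * real (m - k - l)))"
      unfolding sum_negbin_weighted xm ..
    finally show "(1 - x * real m) * (d_coeff r k * negbin (1 - real k / real r) (m - k)) =
      negbin (real k * x) k / real k * (\<Sum>l\<le>m - k. negbin (- (real k * x)) l * (1 - x * real (m - k - l)))"
      using s by simp
  qed
  also have "\<dots> = (\<Sum>i=1..m. x / real i * (1 - x * real (m - i)))"
    by (rule sum_negbin_conv)
  also have "\<dots> = (\<Sum>i=1..m. x * (1 - x * real m) * (1 / real i) + x * x)"
    by (rule sum.cong) (auto simp: of_nat_diff field_simps)
  also have "\<dots> = x * (1 - x * real m) * (\<Sum>i=1..m. 1 / real i) + x * x * real m"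
    unfolding sum.distrib sum_distrib_left[symmetric] by simp
  also have "\<dots> = (1 - x * real m) * (x * (\<Sum>i=1..m. 1 / real i) + (1 / (real r - real m) - x))"
    using r by (simp add: x_def field_simps)
  finally have "d_sum_coeff r m = x * (\<Sum>i=1..m. 1 / real i) + (1 / (real r - real m) - x)"
    using r by (subst (asm) mult_left_cancel) (auto simp: x_def)
  then show ?thesis by (simp add: x_def)
qed

text \<open>
  At \<open>m = r\<close> that multiplier is 0. Instead, the summands are symmetric under \<open>k \<mapsto> r - k\<close> once
  \<open>r / (k * (r - k))\<close> is split into \<open>1 / k + 1 / (r - k)\<close>, and the Lagrange identity summed over all
  orders up to \<open>r\<close> gives the harmonic number that appears in \<open>d_coeff r r\<close>.
\<close>

lemma d_sum_coeff_self:
  assumes "r \<ge> 1"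
  shows "d_sum_coeff r r = 2 / real r * ((\<Sum>i=1..r. 1 / real i) - 1)"
proof -
  define x where "x = 1 / real r"
  define p where "p = (\<lambda>k. negbin (real k * x) k)"
  have "d_sum_coeff r r = (\<Sum>k=1..r - 1. p k / real k * p (r - k) + p (r - k) / real (r - k) * p k)"
    unfolding d_sum_coeff_def
  proof (rule sum.cong)
    show "{1..min r (r - 1)} = {1..r - 1}" by simp
    fix k assume "k \<in> {1..r - 1}"
    then have k: "1 \<le> k" "k < r" by auto
    have "1 - real k / real r = real (r - k) * x"
      using k by (simp add: x_def of_nat_diff field_simps)
    then have "d_coeff r k * negbin (1 - real k / real r) (r - k) =
        real r / (real k * real (r - k)) * p k * p (r - k)"
      using k by (simp add: d_coeff_eq_negbin p_def x_def of_nat_diff)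
    also have "real r / (real k * real (r - k)) = 1 / real k + 1 / real (r - k)"
      using k by (simp add: field_simps of_nat_diff)
    finally show "d_coeff r k * negbin (1 - real k / real r) (r - k) =
      p k / real k * p (r - k) + p (r - k) / real (r - k) * p k"
      by (simp add: algebra_simps)
  qed
  also have "\<dots> = 2 * (\<Sum>k=1..r - 1. p k / real k * p (r - k))"
  proof -
    have "(\<Sum>k=1..r - 1. p (r - k) / real (r - k) * p k) = (\<Sum>k=1..r - 1. p k / real k * p (r - k))"
      by (rule sum.reindex_bij_witness[of _ "\<lambda>k. r - k" "\<lambda>k. r - k"]) auto
    then show ?thesis by (simp add: sum.distrib)
  qed
  also have "(\<Sum>k=1..r - 1. p k / real k * p (r - k)) =
     (\<Sum>k=1..r. p k / real k * (\<Sum>l\<le>r - k. negbin (- (real k * x)) l * 1)) - x"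
  proof -
    have "{1..r} = insert r {1..r - 1}" using assms by auto
    moreover have "p r / real r = x"
      using assms by (simp add: p_def x_def negbin_def pochhammer_fact[symmetric])
    moreover have "(\<Sum>l\<le>r - k. negbin (- (real k * x)) l * 1) = p (r - k)" if "k \<in> {1..r - 1}" for k
    proof -
      have "- (real k * x) + 1 = real (r - k) * x"
      proof -
        have "k \<le> r" "real r > 0" using that assms by auto
        then show ?thesis by (simp add: x_def of_nat_diff field_simps)
      qed
      then show ?thesis using sum_negbin[of "- (real k * x)" "r - k"] by (simp add: p_def)
    qed
    ultimately show ?thesis using assms by simp
  qed
  also have "(\<Sum>k=1..r. p k / real k * (\<Sum>l\<le>r - k. negbin (- (real k * x)) l * 1)) = (\<Sum>i=1..r. x / real i * 1)"
    unfolding p_def by (rule sum_negbin_conv)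
  finally show ?thesis by (simp add: x_def sum_distrib_left algebra_simps sum_divide_distrib)
qed

lemma d_sum_coeff_bounds:
  assumes "r \<ge> 1" "m \<ge> r"
  shows "0 \<le> d_sum_coeff r m" "d_sum_coeff r m \<le> 1"
proof -
  have *: "0 \<le> d_coeff r k * negbin (1 - real k / real r) (m - k) \<and>
        d_coeff r k * negbin (1 - real k / real r) (m - k) \<le> 1 / real r"
    if "k \<in> {1..min m (r - 1)}" for k
  proof -
    from that assms have k: "1 \<le> k" "k < r" by auto
    have s: "0 \<le> real k / real r" "real k / real r \<le> 1" using k by auto
    have d0: "0 \<le> d_coeff r k"
      using k s by (simp add: d_coeff_eq_negbin negbin_nonneg)
    have "d_coeff r k \<le> real r / (real k * (real r - real k)) * (real k / real r)"
      unfolding d_coeff_eq_negbin[OF k] by (rule mult_left_mono[OF negbin_le]) (use s k in auto)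
    also have "\<dots> = 1 / (real r - real k)" using k by simp
    finally have d: "d_coeff r k \<le> 1 / (real r - real k)" .
    have n0: "0 \<le> negbin (1 - real k / real r) (m - k)" by (rule negbin_nonneg) (use s in auto)
    have n1: "negbin (1 - real k / real r) (m - k) \<le> 1 - real k / real r"
      by (rule negbin_le) (use s k assms in auto)
    have "d_coeff r k * negbin (1 - real k / real r) (m - k) \<le>
       1 / (real r - real k) * (1 - real k / real r)"
      by (rule mult_mono[OF d n1]) (use n0 k in auto)
    also have "\<dots> = 1 / real r" using k by (simp add: field_simps)
    finally show ?thesis using d0 n0 by simp
  qed
  show "0 \<le> d_sum_coeff r m" unfolding d_sum_coeff_def by (rule sum_nonneg) (use * in blast)
  have "d_sum_coeff r m \<le> (\<Sum>k=1..min m (r - 1). 1 / real r)"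
    unfolding d_sum_coeff_def by (rule sum_mono) (use * in blast)
  also have "\<dots> \<le> 1" using assms by (auto simp: field_simps)
  finally show "d_sum_coeff r m \<le> 1" .
qed

section \<open>Expansion of the exponent\<close>

lemma neg_ln_div_sums:
  fixes t :: real
  assumes "0 \<le> t" "t < 1"
  shows "(\<lambda>m. (\<Sum>i=1..m. 1 / real i) * t ^ m) sums (- ln (1 - t) / (1 - t))"
proof -
  have ln: "(\<lambda>i. t ^ i / real i) sums (- ln (1 - t))"
    using sums_minus[OF ln_series'[of "-t"]] assms by simp
  have geo: "(\<lambda>i. t ^ i) sums (1 / (1 - t))"
    using geometric_sums[of t] assms by simp
  have "(\<lambda>m. \<Sum>i\<le>m. t ^ i / real i * t ^ (m - i)) sums ((\<Sum>i. t ^ i / real i) * (\<Sum>i. t ^ i))"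
    using ln geo assms by (intro Cauchy_product_sums) (auto dest: sums_summable)
  moreover have "(\<Sum>i\<le>m. t ^ i / real i * t ^ (m - i)) = (\<Sum>i=1..m. 1 / real i) * t ^ m" for m
  proof -
    have "{..m} = insert 0 {1..m}" by auto
    then have "(\<Sum>i\<le>m. t ^ i / real i * t ^ (m - i)) = (\<Sum>i=1..m. t ^ i / real i * t ^ (m - i))" by simp
    also have "\<dots> = (\<Sum>i=1..m. 1 / real i * t ^ m)"
      by (rule sum.cong) (auto simp flip: power_add)
    finally show ?thesis by (simp add: sum_distrib_right)
  qed
  ultimately show ?thesis using ln geo by (simp add: sums_iff)
qed

lemma harmonic_sum_le: "(\<Sum>i=1..m. 1 / real i) \<le> real m"
proof -
  have "(\<Sum>i=1..m. 1 / real i) \<le> (\<Sum>i=1..m. 1)" by (rule sum_mono) auto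
  then show ?thesis by simp
qed

lemma d_sum_coeff_sums:
  fixes t :: real
  assumes "0 \<le> t" "t < 1"
  shows "(\<lambda>m. d_sum_coeff r m * t ^ m) sums
     (\<Sum>k=1..r - 1. d_coeff r k * t ^ k * (1 - t) powr (- (1 - real k / real r)))"
proof -
  have "(\<lambda>m. \<Sum>k=1..r - 1. (if m < k then 0 else d_coeff r k * negbin (1 - real k / real r) (m - k) * t ^ m)) sums
     (\<Sum>k=1..r - 1. d_coeff r k * t ^ k * (1 - t) powr (- (1 - real k / real r)))"
  proof (rule sums_sum)
    fix k
    let ?f = "\<lambda>m. if m < k then 0 else d_coeff r k * negbin (1 - real k / real r) (m - k) * t ^ m"
    have "(\<lambda>j. d_coeff r k * t ^ k * (negbin (1 - real k / real r) j * t ^ j)) sums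
        (d_coeff r k * t ^ k * (1 - t) powr (- (1 - real k / real r)))"
      by (intro sums_mult negbin_sums) (use assms in auto)
    also have "(\<lambda>j. d_coeff r k * t ^ k * (negbin (1 - real k / real r) j * t ^ j)) = (\<lambda>j. ?f (j + k))"
      by (auto simp: power_add)
    finally show "?f sums (d_coeff r k * t ^ k * (1 - t) powr (- (1 - real k / real r)))"
      by (subst (asm) sums_iff_shift) simp
  qed
  moreover have "(\<Sum>k=1..r - 1. (if m < k then 0 else d_coeff r k * negbin (1 - real k / real r) (m - k) * t ^ m))
      = d_sum_coeff r m * t ^ m" for m
    unfolding d_sum_coeff_def sum_distrib_right by (rule sum.mono_neutral_cong_right) auto
  ultimately show ?thesis by simp
qed

lemma sums_linear_geometric:
  fixes t :: real
  assumes t: "0 \<le> t" "t \<le> 2 / 3"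
  shows "(\<lambda>i. (real i + 3) * t ^ i) sums (t / (1 - t)\<^sup>2 + 3 / (1 - t))"
proof -
  have "(\<lambda>n. real n * t ^ n) sums (t / (1 - t)\<^sup>2)"
  proof -
    have "(\<lambda>n. real (Suc n) * t ^ n) sums (1 / (1 - t)\<^sup>2)" using geometric_deriv_sums[of t] t by simp
    from sums_mult[OF this, of t] have "(\<lambda>n. real (Suc n) * t ^ Suc n) sums (t / (1 - t)\<^sup>2)"
      by (simp add: mult_ac del: of_nat_Suc)
    then show ?thesis using sums_Suc_iff[of "\<lambda>n. real n * t ^ n"] by simp
  qed
  moreover have "(\<lambda>n. 3 * t ^ n) sums (3 * (1 / (1 - t)))"
    by (intro sums_mult geometric_sums) (use t in auto)
  ultimately show ?thesis using sums_add by (fastforce simp: algebra_simps)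
qed

text \<open>
  The difference of the two exponents, multiplied by \<open>t ^ r\<close>, is a power series in \<open>t\<close>. Its coefficients
  up to order \<open>r\<close> vanish, and that of \<open>t ^ (r + 1 + i)\<close> is at most \<open>i + 3\<close> in absolute value, so that
  dividing by \<open>t ^ r\<close> leaves \<open>O(t)\<close>. The logarithms enter this series through \<open>n * ln t + n * ln n / r = - n * ln (1 - t) / r\<close>.
\<close>

lemma saddle_exponent:
  fixes t n :: real
  assumes r: "r \<ge> 1" and t: "0 < t" "t \<le> 2 / 3" and n: "n = 1 / (t ^ r * (1 - t))"
  shows "\<bar>(\<Sum>j=1..r. (1 / t) ^ j / real j) + n * ln t -
     (- (n * ln n / real r) + n / real r + (\<Sum>k=1..r. d_coeff r k * n powr ((real r - real k) / real r)))\<bar> \<le> 18 * t"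
proof -
  define H where "H = (\<lambda>m. \<Sum>i=1..m. 1 / real i)"
  \<comment> \<open>the coefficients of the difference of the two exponents, multiplied by \<open>t ^ r\<close>\<close>
  define S where "S = (\<lambda>m. (if m < r then 1 / (real r - real m) else 0) + H m / real r - 1 / real r
     - d_sum_coeff r m - (if m = r then d_coeff r r else 0))"
  define E where "E = (\<Sum>j=1..r. (1 / t) ^ j / real j) + n * ln t -
     (- (n * ln n / real r) + n / real r + (\<Sum>k=1..r. d_coeff r k * n powr ((real r - real k) / real r)))"
  have t1: "t < 1" "0 \<le> t" using t by auto
  have n0: "n > 0" using n t by simp
  have H_r: "H r = (\<Sum>j=2..r. 1 / real j) + 1"
  proof -
    have "{1..r} = insert 1 {2..r}" using r by auto
    then show ?thesis by (simp add: H_def)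
  qed
  have drr: "d_coeff r r = - (H r - 1) / real r"
    unfolding H_r by (simp add: d_coeff_def)
  have S0: "S m = 0" if "m \<le> r" for m
  proof (cases "m = r")
    case True
    have tl: "d_sum_coeff r r = 2 / real r * (H r - 1)" using r by (simp add: d_sum_coeff_self H_def)
    have "S r = 0" unfolding S_def drr tl using r by (simp add: field_simps)
    then show ?thesis using True by simp
  next
    case False
    then show ?thesis using that by (simp add: S_def d_sum_coeff_less H_def)
  qed
  have S1: "\<bar>S (i + Suc r)\<bar> \<le> real i + 3" for i
  proof -
    have "H (i + Suc r) \<le> real (i + Suc r)" unfolding H_def by (rule harmonic_sum_le)
    then have "H (i + Suc r) / real r \<le> real (i + Suc r) / real r" by (rule divide_right_mono) simp
    also have "\<dots> = 1 + (real i + 1) / real r" using r by (simp add: field_simps)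
    also have "(real i + 1) / real r \<le> real i + 1"
      using r divide_left_mono[of 1 "real r" "real i + 1"] by simp
    finally have h: "H (i + Suc r) / real r \<le> real i + 2" by simp
    have h0: "0 \<le> H (i + Suc r) / real r" by (simp add: H_def sum_nonneg)
    have "0 \<le> 1 / real r" "1 / real r \<le> 1" using r by auto
    moreover have "S (i + Suc r) = H (i + Suc r) / real r - 1 / real r - d_sum_coeff r (i + Suc r)"
      by (simp add: S_def)
    ultimately show ?thesis using h h0 d_sum_coeff_bounds[of r "i + Suc r"] r by linarith
  qed
  have sumsS: "(\<lambda>m. S m * t ^ m) sums (t ^ r * E)"
  proof -
    let ?D = "\<Sum>k=1..r - 1. d_coeff r k * t ^ k * (1 - t) powr (- (1 - real k / real r))"
    have "(\<lambda>m. if m \<in> {..<r} then t ^ m / (real r - real m) else 0) sums (\<Sum>m<r. t ^ m / (real r - real m))"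
      by (rule sums_If_finite_set) auto
    moreover have "(\<lambda>m. H m * t ^ m / real r) sums (- ln (1 - t) / (1 - t) / real r)"
      using sums_divide[OF neg_ln_div_sums[OF t1(2,1)]] by (simp add: H_def)
    moreover have "(\<lambda>m. t ^ m / real r) sums (1 / (1 - t) / real r)"
      by (intro sums_divide geometric_sums) (use t1 in auto)
    moreover note d_sum_coeff_sums[OF t1(2,1), of r]
    moreover have "(\<lambda>m. if m \<in> {r} then d_coeff r m * t ^ m else 0) sums (\<Sum>m\<in>{r}. d_coeff r m * t ^ m)"
      by (rule sums_If_finite_set) auto
    ultimately have "(\<lambda>m. (if m \<in> {..<r} then t ^ m / (real r - real m) else 0) + H m * t ^ m / real r
       - t ^ m / real r - d_sum_coeff r m * t ^ m - (if m \<in> {r} then d_coeff r m * t ^ m else 0)) sums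
       ((\<Sum>m<r. t ^ m / (real r - real m)) + (- ln (1 - t) / (1 - t) / real r) - (1 / (1 - t) / real r) - ?D
         - (\<Sum>m\<in>{r}. d_coeff r m * t ^ m))"
      by (intro sums_diff sums_add)
    moreover have "(\<lambda>m. (if m \<in> {..<r} then t ^ m / (real r - real m) else 0) + H m * t ^ m / real r
       - t ^ m / real r - d_sum_coeff r m * t ^ m - (if m \<in> {r} then d_coeff r m * t ^ m else 0)) = (\<lambda>m. S m * t ^ m)"
      by (auto simp: S_def algebra_simps)
    moreover have e1: "(\<Sum>m<r. t ^ m / (real r - real m)) = t ^ r * (\<Sum>j=1..r. (1 / t) ^ j / real j)"
      unfolding sum_distrib_left
      by (rule sum.reindex_bij_witness[of _ "\<lambda>j. r - j" "\<lambda>j. r - j"])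
         (use t in \<open>auto simp: of_nat_diff power_diff field_simps\<close>)
    moreover have e2: "- ln (1 - t) / (1 - t) / real r = t ^ r * (n * ln t + n * ln n / real r)"
    proof -
      have ln_n: "ln n = - (real r * ln t) - ln (1 - t)"
        using t by (simp add: n ln_div ln_mult ln_realpow)
      have "n * ln t + n * ln n / real r = n * (- ln (1 - t) / real r)"
        unfolding ln_n using r by (simp add: field_simps)
      then show ?thesis using t r by (simp add: n field_simps)
    qed
    moreover have e3: "1 / (1 - t) / real r = t ^ r * (n / real r)"
      using t by (simp add: n)
    moreover have e4: "?D + (\<Sum>m\<in>{r}. d_coeff r m * t ^ m) =
      t ^ r * (\<Sum>k=1..r. d_coeff r k * n powr ((real r - real k) / real r))"
    proof -
      have "{1..r} = insert r {1..r - 1}" using r by auto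
      then have "(\<Sum>k=1..r. d_coeff r k * n powr ((real r - real k) / real r)) =
         d_coeff r r + (\<Sum>k=1..r - 1. d_coeff r k * n powr ((real r - real k) / real r))"
        using n0 r by simp
      moreover have "?D = t ^ r * (\<Sum>k=1..r - 1. d_coeff r k * n powr ((real r - real k) / real r))"
        unfolding sum_distrib_left
      proof (rule sum.cong[OF refl])
        fix k assume "k \<in> {1..r - 1}"
        then have k: "1 \<le> k" "k < r" by auto
        have "n powr ((real r - real k) / real r) = (t powr real r * (1 - t)) powr (- ((real r - real k) / real r))"
          using t by (simp add: n powr_realpow powr_minus_divide powr_divide)
        also have "\<dots> = t powr (real r * (- ((real r - real k) / real r))) * (1 - t) powr (- ((real r - real k) / real r))"
          using t by (simp add: powr_mult powr_powr)
        also have "real r * (- ((real r - real k) / real r)) = real k - real r" using r by simp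
        also have "- ((real r - real k) / real r) = - (1 - real k / real r)" using r by (simp add: diff_divide_distrib)
        also have "t powr (real k - real r) = t ^ k / t ^ r"
          using t by (simp add: powr_diff powr_realpow)
        finally show "d_coeff r k * t ^ k * (1 - t) powr (- (1 - real k / real r)) =
          t ^ r * (d_coeff r k * n powr ((real r - real k) / real r))"
          using t by simp
      qed
      ultimately show ?thesis by (simp add: algebra_simps)
    qed
    moreover have "t ^ r * E = t ^ r * (\<Sum>j=1..r. (1 / t) ^ j / real j) + t ^ r * (n * ln t + n * ln n / real r)
       - t ^ r * (n / real r) - t ^ r * (\<Sum>k=1..r. d_coeff r k * n powr ((real r - real k) / real r))"
      unfolding E_def by (simp only: distrib_left right_diff_distrib minus_add_distrib mult_minus_right)
    then have "(\<Sum>m<r. t ^ m / (real r - real m)) + (- ln (1 - t) / (1 - t) / real r) - (1 / (1 - t) / real r) - ?D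
         - (\<Sum>m\<in>{r}. d_coeff r m * t ^ m) = t ^ r * E"
      using e1 e2 e3 e4 by linarith
    ultimately show ?thesis by (simp only:)
  qed
  have "(\<Sum>m<Suc r. S m * t ^ m) = 0" by (rule sum.neutral) (use S0 in auto)
  then have sh: "(\<lambda>i. S (i + Suc r) * t ^ (i + Suc r)) sums (t ^ r * E)"
    using sumsS sums_iff_shift[of "\<lambda>m. S m * t ^ m" "Suc r"] by simp
  have bd: "(\<lambda>i. t ^ Suc r * ((real i + 3) * t ^ i)) sums (t ^ Suc r * (t / (1 - t)\<^sup>2 + 3 / (1 - t)))"
    by (intro sums_mult sums_linear_geometric) (use t in auto)
  have le: "\<bar>S (i + Suc r) * t ^ (i + Suc r)\<bar> \<le> t ^ Suc r * ((real i + 3) * t ^ i)" for i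
  proof -
    have "\<bar>S (i + Suc r) * t ^ (i + Suc r)\<bar> = \<bar>S (i + Suc r)\<bar> * t ^ (i + Suc r)"
      using t by (simp add: abs_mult)
    also have "\<dots> \<le> (real i + 3) * t ^ (i + Suc r)"
      by (rule mult_right_mono[OF S1]) (use t in auto)
    finally show ?thesis by (simp add: power_add mult_ac)
  qed
  have "\<bar>t ^ r * E\<bar> \<le> t ^ Suc r * (t / (1 - t)\<^sup>2 + 3 / (1 - t))"
  proof -
    have "norm (\<Sum>i. S (i + Suc r) * t ^ (i + Suc r)) \<le> (\<Sum>i. t ^ Suc r * ((real i + 3) * t ^ i))"
      by (rule norm_suminf_le) (use le bd in \<open>auto dest: sums_summable\<close>)
    then show ?thesis using sh bd by (simp add: sums_iff)
  qed
  also have "t / (1 - t)\<^sup>2 + 3 / (1 - t) \<le> 18"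
  proof -
    have "1 / (1 - t) \<le> 3" using t by (simp add: field_simps)
    moreover from this have "t / (1 - t)\<^sup>2 \<le> 1 * 3\<^sup>2"
      using t mult_mono[of t 1 "(1 / (1 - t))\<^sup>2" "3\<^sup>2"] power_mono[of "1 / (1 - t)" 3 2]
      by (simp add: power_divide)
    ultimately show ?thesis by simp
  qed
  finally have "\<bar>t ^ r * E\<bar> \<le> t ^ Suc r * 18" using t by simp
  then have "t ^ r * \<bar>E\<bar> \<le> t ^ r * (18 * t)" using t by (simp add: abs_mult mult_ac)
  then have "\<bar>E\<bar> \<le> 18 * t" using t by (subst (asm) mult_le_cancel_left_pos) auto
  then show ?thesis by (simp add: E_def)
qed

section \<open>Uniform asymptotics\<close>

definition main_term :: "nat \<Rightarrow> nat \<Rightarrow> real" where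
  "main_term n r = 1 / sqrt (2 * pi * real n * real r) *
        exp (- (real n * ln (real n) / real r) + real n / real r
             + (\<Sum>k=1..r. d_coeff r k * real n powr ((real r - real k) / real r)))"

lemma main_term_pos: "n \<ge> 1 \<Longrightarrow> r \<ge> 1 \<Longrightarrow> main_term n r > 0"
  by (simp add: main_term_def)

lemma exp_one_ge: "27 / 10 \<le> exp (1 :: real)"
proof -
  have "27 / 10 \<le> (1 + 1 / 5 + (1 / 5)\<^sup>2 / 2 :: real) ^ 5" by (simp add: eval_nat_numeral)
  also have "\<dots> \<le> exp (1 / 5) ^ 5"
    by (intro power_mono exp_lower_Taylor_quadratic) auto
  also have "\<dots> = exp (1 :: real)" by (simp add: exp_of_nat_mult[symmetric])
  finally show ?thesis .
qed

text \<open>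
  The function \<open>t ^ r * (1 - t)\<close> at \<open>t = 2 / 3\<close> must not be below \<open>1 / n\<close>. As \<open>n \<ge> exp r\<close>, this follows from
  \<open>2 / 3 * exp 1 \<ge> 9 / 5\<close> and \<open>(9 / 5) ^ 2 \<ge> 3\<close> when \<open>r \<ge> 2\<close>; for \<open>r = 1\<close> it means \<open>n \<ge> 9 / 2\<close>.
\<close>

lemma exists_saddle:
  assumes r: "r \<ge> 1" "real r \<le> ln (real n)" and n: "n \<ge> 5"
  shows "\<exists>t>0. t \<le> 2 / 3 \<and> real n * (t ^ r * (1 - t)) = 1"
proof -
  have big: "1 \<le> real n * ((2 / 3) ^ r * (1 - 2 / 3))"
  proof (cases "r = 1")
    case True
    then show ?thesis using n by simp
  next
    case False
    then have r2: "r \<ge> 2" using r by simp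
    have "exp (real r) \<le> real n" using r n by (simp add: ln_ge_iff)
    then have "exp 1 ^ r \<le> real n" by (simp add: exp_of_nat_mult[symmetric])
    moreover have "(27 / 10) ^ r \<le> exp (1::real) ^ r" by (rule power_mono[OF exp_one_ge]) simp
    ultimately have "(27 / 10) ^ r \<le> real n" by simp
    then have "(27 / 10) ^ r * (2 / 3) ^ r \<le> real n * (2 / 3) ^ r" by (rule mult_right_mono) simp
    then have "(9 / 5) ^ r \<le> real n * (2 / 3) ^ r" by (simp add: power_mult_distrib[symmetric])
    moreover have "(9 / 5) ^ 2 \<le> (9 / 5 :: real) ^ r" by (rule power_increasing) (use r2 in auto)
    ultimately show ?thesis by (simp add: power2_eq_square)
  qed
  have "\<exists>t\<ge>0. t \<le> 2 / 3 \<and> real n * (t ^ r * (1 - t)) = 1"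
    by (rule IVT'[of "\<lambda>t. real n * (t ^ r * (1 - t))"])
       (use big r in \<open>auto intro!: continuous_intros simp: power_0_left\<close>)
  then obtain t where t: "t \<ge> 0" "t \<le> 2 / 3" "real n * (t ^ r * (1 - t)) = 1" by auto
  moreover have "t \<noteq> 0" using t(3) r by (intro notI) (simp add: power_0_left)
  ultimately show ?thesis by (intro exI[of _ t]) auto
qed

context near_saddle
begin

abbreviation "u \<equiv> real n powr (- 1 / real r)"

lemma t_bounds: "u \<le> t" "t \<le> 3 * u"
proof -
  have tr: "t powr real r = 1 / (real n * (1 - t))"
    using n_eq t n by (simp add: powr_realpow field_simps)
  have t_eq: "(t powr real r) powr (1 / real r) = t" using t r by (simp add: powr_powr)
  have u_eq: "u = (1 / real n) powr (1 / real r)"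
    using n by (simp add: powr_divide powr_minus_divide)
  have l: "1 / real n \<le> t powr real r" and h: "t powr real r \<le> 3 * (1 / real n)"
    unfolding tr using t n by (auto simp: field_simps)
  have "(1 / real n) powr (1 / real r) \<le> (t powr real r) powr (1 / real r)"
    by (rule powr_mono2[OF _ _ l]) auto
  then show "u \<le> t" unfolding t_eq u_eq .
  have "(t powr real r) powr (1 / real r) \<le> (3 * (1 / real n)) powr (1 / real r)"
    by (rule powr_mono2[OF _ _ h]) auto
  also have "\<dots> = 3 powr (1 / real r) * u" unfolding u_eq by (rule powr_mult)
  also have "\<dots> \<le> 3 powr 1 * u"
    by (intro mult_right_mono powr_mono) (use r in auto)
  finally show "t \<le> 3 * u" unfolding t_eq by simp
qed

text \<open>
  Here \<open>n * t \<ge> n powr (1 - 1 / r) \<ge> sqrt n\<close>, while \<open>r\<close> is at most \<open>ln n\<close>.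
\<close>

lemma minor_arc_negligible:
  assumes small: "exp (- (sqrt (real n) / (9 * ln (real n) ^ 3))) \<le> 1 / real n"
    and rl: "real r \<le> ln (real n)" and r2: "r \<ge> 2"
  shows "exp (- (real n * t / (9 * real r ^ 3))) \<le> 1 / real n"
proof -
  have "sqrt (real n) \<le> real n * t"
  proof -
    have "sqrt (real n) = real n powr (1 / 2)" using n by (simp add: powr_half_sqrt)
    also have "\<dots> \<le> real n powr (1 + - 1 / real r)"
      by (rule powr_mono) (use r2 n in \<open>auto simp: field_simps\<close>)
    also have "\<dots> = real n * u" using n by (subst powr_add) simp
    also have "\<dots> \<le> real n * t" by (rule mult_left_mono[OF t_bounds(1)]) simp
    finally show ?thesis .
  qed
  moreover have "real r ^ 3 \<le> ln (real n) ^ 3" by (rule power_mono[OF rl]) simp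
  ultimately have "sqrt (real n) / (9 * ln (real n) ^ 3) \<le> real n * t / (9 * real r ^ 3)"
    using r t by (intro frac_le) auto
  then have "exp (- (real n * t / (9 * real r ^ 3))) \<le> exp (- (sqrt (real n) / (9 * ln (real n) ^ 3)))"
    by simp
  then show ?thesis using small by (rule order_trans)
qed

text \<open>
  The relative error of the saddle point approximation is combined with the factor \<open>exp E\<close>, where \<open>E\<close> is the
  error of the expansion of the exponent. The bound \<open>\<bar>E\<bar> \<le> 18 * t \<le> 18\<close> explains the constant \<open>exp 18\<close>.
\<close>

lemma nu_near_main_term:
  assumes small: "exp (- (sqrt (real n) / (9 * ln (real n) ^ 3))) \<le> 1 / real n"
    and rl: "real r \<le> ln (real n)"
  shows "\<bar>nu n r / main_term n r - 1\<bar> \<le> 1000 * exp 18 * (u + sqrt (real r / real n))"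
proof -
  define P where "P = exp ((\<Sum>j=1..r. x ^ j / real j) + real n * ln t) / sqrt (2 * pi * real n * real r)"
  define w where "w = sqrt (real r / real n)"
  define E where "E = (\<Sum>j=1..r. x ^ j / real j) + real n * ln t -
     (- (real n * ln (real n) / real r) + real n / real r + (\<Sum>k=1..r. d_coeff r k * real n powr ((real r - real k) / real r)))"
  have P0: "P > 0" using r n by (simp add: P_def)
  have w0: "w \<ge> 0" by (simp add: w_def)
  have u0: "u \<ge> 0" by simp
  have nP: "\<bar>nu n r / P - 1\<bar> \<le> 200 * (t + w)"
    unfolding P_def w_def by (rule nu_near_saddle) (use minor_arc_negligible[OF small rl] in auto)
  have "\<bar>E\<bar> \<le> 18 * t"
    unfolding E_def x_def by (rule saddle_exponent[OF r t]) (use n_eq t n in \<open>auto simp: field_simps\<close>)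
  moreover have "P = main_term n r * exp E"
    unfolding P_def main_term_def E_def by (simp add: exp_add[symmetric] field_simps)
  ultimately have E: "\<bar>E\<bar> \<le> 18 * t" and PE: "P = main_term n r * exp E" by auto
  have E18: "\<bar>E\<bar> \<le> 18" using E t by simp
  have exp_le: "exp E \<le> exp 18" using E18 by simp
  have eE: "\<bar>exp E - 1\<bar> \<le> exp 18 * \<bar>E\<bar>" by (rule abs_exp_minus_one_le[OF E18])
  have m0: "main_term n r > 0" by (rule main_term_pos[OF n r])
  have "nu n r / main_term n r - 1 = (nu n r / P - 1) * exp E + (exp E - 1)"
    unfolding PE using m0 by (simp add: field_simps)
  also have "\<bar>\<dots>\<bar> \<le> \<bar>nu n r / P - 1\<bar> * exp E + \<bar>exp E - 1\<bar>"
    by (metis abs_exp_cancel abs_mult abs_triangle_ineq)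
  also have "\<dots> \<le> 200 * (t + w) * exp 18 + exp 18 * (18 * t)"
  proof (rule add_mono)
    show "\<bar>nu n r / P - 1\<bar> * exp E \<le> 200 * (t + w) * exp 18"
      by (rule mult_mono[OF nP exp_le]) (use t w0 in auto)
    show "\<bar>exp E - 1\<bar> \<le> exp 18 * (18 * t)"
      by (rule order_trans[OF eE mult_left_mono[OF E]]) simp
  qed
  also have "\<dots> \<le> 1000 * exp 18 * (u + w)"
  proof -
    have "200 * (t + w) + 18 * t \<le> 1000 * (u + w)" unfolding distrib_left using t_bounds(2) u0 w0 by linarith
    then have "exp 18 * (200 * (t + w) + 18 * t) \<le> exp 18 * (1000 * (u + w))" by (rule mult_left_mono) simp
    then show ?thesis by (simp add: algebra_simps)
  qed
  finally show ?thesis by (simp add: w_def)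
qed

end

lemma nu_near_main_term_eventually:
  "\<exists>N. \<forall>n\<ge>N. \<forall>r. 1 \<le> r \<longrightarrow> real r \<le> ln (real n) \<longrightarrow>
     \<bar>nu n r / main_term n r - 1\<bar> \<le> 1000 * exp 18 * (real n powr (- 1 / real r) + sqrt (real r / real n))"
proof -
  have "eventually (\<lambda>n::nat. exp (- (sqrt (real n) / (9 * ln (real n) ^ 3))) \<le> 1 / real n) at_top"
    by real_asymp
  then obtain N where N: "\<And>n::nat. n \<ge> N \<Longrightarrow> exp (- (sqrt (real n) / (9 * ln (real n) ^ 3))) \<le> 1 / real n"
    by (auto simp: eventually_at_top_linorder)
  have "\<bar>nu n r / main_term n r - 1\<bar> \<le> 1000 * exp 18 * (real n powr (- 1 / real r) + sqrt (real r / real n))"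
    if n5: "n \<ge> max N 5" and r1: "1 \<le> r" and rl: "real r \<le> ln (real n)" for n r
  proof -
    obtain t where t: "t > 0" "t \<le> 2 / 3" "real n * (t ^ r * (1 - t)) = 1"
      using exists_saddle[OF r1 rl] n5 by auto
    interpret near_saddle r n t "1 / t"
      by standard (use t n5 r1 in auto)
    show ?thesis by (rule nu_near_main_term[OF N rl]) (use n5 in simp)
  qed
  then show ?thesis by blast
qed

text \<open>
  The claim amounts to \<open>r \<le> 4 * n powr (1 - 2 / r)\<close>, and \<open>n \<ge> exp r\<close> makes the power at least
  \<open>exp (r - 2) \<ge> r - 1\<close>.
\<close>

lemma sqrt_ratio_le:
  assumes r: "r \<ge> 2" "real r \<le> ln (real n)" and n: "n \<ge> 1"
  shows "sqrt (real r / real n) \<le> 2 * real n powr (- 1 / real r)"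
proof -
  have en: "exp (real r) \<le> real n" using r n by (simp add: ln_ge_iff)
  have "real r \<le> 2 * (1 + (real r - 2))" using r by simp
  also have "1 + (real r - 2) \<le> exp (real r - 2)" by (rule exp_ge_add_one_self)
  also have "exp (real r - 2) = exp (real r) powr (1 - 2 / real r)"
    using r by (simp add: powr_def field_simps)
  also have "\<dots> \<le> real n powr (1 - 2 / real r)"
    by (rule powr_mono2[OF _ _ en]) (use r in \<open>auto simp: field_simps\<close>)
  finally have "real r / real n \<le> 2 * (real n powr (1 - 2 / real r) / real n)"
    using n by (simp add: field_simps)
  also have "real n powr (1 - 2 / real r) / real n = (real n powr (- 1 / real r))\<^sup>2"
  proof -
    have "real n powr (1 - 2 / real r) / real n = real n powr (- (2 / real r))"
      using n by (simp add: powr_diff powr_minus_divide)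
    also have "\<dots> = (real n powr (- 1 / real r))\<^sup>2"
      by (simp add: power2_eq_square flip: powr_add)
    finally show ?thesis .
  qed
  also have "2 * (real n powr (- 1 / real r))\<^sup>2 \<le> (2 * real n powr (- 1 / real r))\<^sup>2"
    by (simp add: power_mult_distrib)
  finally show ?thesis by (rule real_le_lsqrt[rotated]) simp
qed

lemma nu_1_Suc: "real (Suc n) * nu (Suc n) 1 = nu n 1"
proof -
  have "complex_of_real (real (Suc n) * nu (Suc n) 1) = of_nat (Suc n) * egf_coeff 1 (Suc n)"
    by (simp add: nu_eq_egf_coeff del: of_nat_Suc)
  also have "\<dots> = complex_of_real (nu n 1)"
    unfolding egf_coeff_rec by (simp add: nu_eq_egf_coeff)
  finally show ?thesis by (simp only: of_real_eq_iff)
qed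

text \<open>
  Under the step condition, \<open>f n - 1 / n\<close> increases to its limit 0 and \<open>f n + 1 / n\<close> decreases to it.
\<close>

lemma abs_le_inverse_of_telescoping:
  fixes f :: "nat \<Rightarrow> real"
  assumes lim: "f \<longlonglongrightarrow> 0"
    and step: "\<And>n. n \<ge> N \<Longrightarrow> \<bar>f n - f (Suc n)\<bar> \<le> 1 / real n - 1 / real (Suc n)"
    and n: "n \<ge> N"
  shows "\<bar>f n\<bar> \<le> 1 / real n"
proof -
  have inv: "(\<lambda>m. 1 / real (m + N)) \<longlonglongrightarrow> 0"
    by (rule LIMSEQ_ignore_initial_segment) (rule lim_1_over_n)
  have lim': "(\<lambda>m. f (m + N)) \<longlonglongrightarrow> 0" by (rule LIMSEQ_ignore_initial_segment[OF lim])
  have st: "\<bar>f (m + N) - f (Suc m + N)\<bar> \<le> 1 / real (m + N) - 1 / real (Suc m + N)" for m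
    using step[of "m + N"] by simp
  have "incseq (\<lambda>m. f (m + N) - 1 / real (m + N))"
  proof (rule incseq_SucI)
    show "f (m + N) - 1 / real (m + N) \<le> f (Suc m + N) - 1 / real (Suc m + N)" for m
      using st[of m] by linarith
  qed
  moreover have "(\<lambda>m. f (m + N) - 1 / real (m + N)) \<longlonglongrightarrow> 0 - 0" by (intro tendsto_diff lim' inv)
  ultimately have "f (m + N) - 1 / real (m + N) \<le> 0" for m
    using incseq_le[of "\<lambda>m. f (m + N) - 1 / real (m + N)" 0 m] by simp
  moreover have "decseq (\<lambda>m. f (m + N) + 1 / real (m + N))"
  proof (rule decseq_SucI)
    show "f (Suc m + N) + 1 / real (Suc m + N) \<le> f (m + N) + 1 / real (m + N)" for m
      using st[of m] by linarith
  qed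
  moreover have "(\<lambda>m. f (m + N) + 1 / real (m + N)) \<longlonglongrightarrow> 0 + 0" by (intro tendsto_add lim' inv)
  ultimately have "f (m + N) - 1 / real (m + N) \<le> 0 \<and> 0 \<le> f (m + N) + 1 / real (m + N)" for m
    using decseq_ge[of "\<lambda>m. f (m + N) + 1 / real (m + N)" 0 m] by simp
  from this[of "n - N"] n show ?thesis by (simp add: abs_le_iff)
qed

text \<open>
  Stirling's formula with its classical error rate, since \<open>nu n 1 = 1 / n!\<close>. The limit of the logarithmic
  error \<open>f\<close> is 0 by the weaker general bound, and \<open>f n - f (n + 1) = 1 - (n + 1 / 2) * ln (1 + 1 / n)\<close> is
  \<open>O(1 / n ^ 2)\<close>.
\<close>

lemma nu_1_main_term:
  "\<exists>N. \<forall>n\<ge>N. \<bar>nu n 1 / main_term n 1 - 1\<bar> \<le> 3 * (1 / real n)"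
proof -
  define f where "f = (\<lambda>n. ln (nu n 1 / main_term n 1))"
  have d: "d_coeff 1 1 = 0" by (simp add: d_coeff_def)
  have main: "main_term n 1 = exp (real n - real n * ln (real n)) / sqrt (2 * pi * real n)" for n
    by (simp add: main_term_def d[simplified])
  obtain N1 where N1: "\<And>n. n \<ge> N1 \<Longrightarrow> 1 \<le> ln (real n) \<Longrightarrow>
      \<bar>nu n 1 / main_term n 1 - 1\<bar> \<le> 1000 * exp 18 * (real n powr (- 1) + sqrt (1 / real n))"
    using nu_near_main_term_eventually by (metis nle_le of_nat_1 div_by_1)
  have "eventually (\<lambda>n. 1 \<le> ln (real n)) at_top" by real_asymp
  then have "eventually (\<lambda>n. norm (nu n 1 / main_term n 1 - 1) \<le> 1000 * exp 18 * (real n powr (- 1) + sqrt (1 / real n))) at_top"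
    using eventually_ge_at_top[of N1] by eventually_elim (use N1 in auto)
  moreover have "(\<lambda>n. 1000 * exp 18 * (real n powr (- 1) + sqrt (1 / real n))) \<longlonglongrightarrow> 0" by real_asymp
  ultimately have "(\<lambda>n. nu n 1 / main_term n 1 - 1) \<longlonglongrightarrow> 0" by (rule Lim_null_comparison)
  then have "(\<lambda>n. nu n 1 / main_term n 1) \<longlonglongrightarrow> 1" by (simp add: LIM_zero_iff)
  then have "f \<longlonglongrightarrow> ln 1" unfolding f_def by (intro tendsto_ln) auto
  then have lim: "f \<longlonglongrightarrow> 0" by simp
  have f_diff: "f n - f (Suc n) = 1 - (real n + 1 / 2) * ln (1 + 1 / real n)" if n: "n \<ge> 1" for n
  proof -
    have f: "f m = ln (nu m 1) - (real m - real m * ln (real m)) + (ln (2 * pi) + ln (real m)) / 2" if "m \<ge> 1" for m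
      using that nu_pos[of 1 m] unfolding f_def main
      by (simp add: ln_div ln_mult ln_sqrt)
    define a b where "a = ln (real n)" and "b = ln (real (Suc n))"
    have nu_n: "ln (nu n 1) = b + ln (nu (Suc n) 1)"
      unfolding nu_1_Suc[of n, symmetric] b_def using nu_pos[of 1 "Suc n"] by (subst ln_mult) auto
    have "1 + 1 / real n = real (Suc n) / real n" using n by (simp add: field_simps)
    then have ln_eq: "ln (1 + 1 / real n) = b - a"
      using n by (simp only: a_def b_def) (subst ln_div, auto)
    have "f n = b + ln (nu (Suc n) 1) - (real n - real n * a) + (ln (2 * pi) + a) / 2"
      using f[OF n] unfolding nu_n a_def .
    moreover have "f (Suc n) = ln (nu (Suc n) 1) - ((real n + 1) - (real n + 1) * b) + (ln (2 * pi) + b) / 2"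
      using f[of "Suc n"] by (simp add: b_def add.commute)
    ultimately show ?thesis unfolding ln_eq by (simp add: field_simps)
  qed
  have "eventually (\<lambda>n. \<bar>1 - (real n + 1 / 2) * ln (1 + 1 / real n)\<bar> \<le> 1 / real n - 1 / real (Suc n)) at_top"
    by real_asymp
  then obtain N2 where N2: "\<And>n. n \<ge> N2 \<Longrightarrow> \<bar>1 - (real n + 1 / 2) * ln (1 + 1 / real n)\<bar> \<le> 1 / real n - 1 / real (Suc n)"
    by (auto simp: eventually_at_top_linorder)
  have "\<bar>nu n 1 / main_term n 1 - 1\<bar> \<le> 3 * (1 / real n)" if n: "n \<ge> max N2 1" for n
  proof -
    have fn: "\<bar>f n\<bar> \<le> 1 / real n"
      by (rule abs_le_inverse_of_telescoping[OF lim, of "max N2 1"]) (use f_diff N2 n in auto)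
    have f1: "\<bar>f n\<bar> \<le> 1" by (rule order_trans[OF fn]) (use n in simp)
    have "\<bar>exp (f n) - 1\<bar> \<le> exp 1 * \<bar>f n\<bar>" by (rule abs_exp_minus_one_le[OF f1])
    also have "\<dots> \<le> 3 * (1 / real n)"
      by (rule mult_mono[OF exp_le fn]) auto
    also have "exp (f n) = nu n 1 / main_term n 1"
      using nu_pos[of 1 n] main_term_pos[of n 1] n by (simp add: f_def)
    finally show ?thesis .
  qed
  then show ?thesis by blast
qed

theorem theorem2p2:
  shows "\<exists>C>0. \<forall>n r :: nat. n \<ge> 1 \<longrightarrow> 1 \<le> r \<longrightarrow> real r \<le> ln (real n) \<longrightarrow>
    (\<exists>\<epsilon>::real. \<bar>\<epsilon>\<bar> \<le> C * real n powr (- 1 / real r) \<and>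
      nu n r = 1 / sqrt (2 * pi * real n * real r) *
        exp (- (real n * ln (real n) / real r) + real n / real r
             + (\<Sum>k=1..r. d_coeff r k * real n powr ((real r - real k) / real r)))
        * (1 + \<epsilon>))"
proof -
  define err where "err = (\<lambda>n r. nu n r / main_term n r - 1)"
  obtain N1 where N1: "\<And>n r. n \<ge> N1 \<Longrightarrow> 1 \<le> r \<Longrightarrow> real r \<le> ln (real n) \<Longrightarrow>
      \<bar>err n r\<bar> \<le> 1000 * exp 18 * (real n powr (- 1 / real r) + sqrt (real r / real n))"
    using nu_near_main_term_eventually unfolding err_def by blast
  obtain N2 where N2: "\<And>n. n \<ge> N2 \<Longrightarrow> \<bar>err n 1\<bar> \<le> 3 * (1 / real n)"
    using nu_1_main_term unfolding err_def by blast
  define N where "N = max N1 N2"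
  \<comment> \<open>the finitely many pairs with \<open>n < N\<close> are covered by the sum of their errors\<close>
  define C0 where "C0 = (\<Sum>n<N. \<Sum>r\<le>n. \<bar>err n r\<bar> * real n powr (1 / real r))"
  define C where "C = C0 + 3000 * exp 18"
  have C0: "C0 \<ge> 0" by (auto simp: C0_def intro!: sum_nonneg)
  have bound: "\<bar>err n r\<bar> \<le> C * real n powr (- 1 / real r)"
    if n: "n \<ge> 1" and r: "1 \<le> r" "real r \<le> ln (real n)" for n r
  proof -
    let ?u = "real n powr (- 1 / real r)"
    consider "n < N" | "n \<ge> N" "r = 1" | "n \<ge> N" "r \<ge> 2" using r by linarith
    then show ?thesis
    proof cases
      case 1
      have "ln (real n) \<le> real n" using ln_le_minus_one[of "real n"] n by simp
      then have rn: "r \<le> n" using r by simp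
      have "\<bar>err n r\<bar> * real n powr (1 / real r) \<le> (\<Sum>r\<le>n. \<bar>err n r\<bar> * real n powr (1 / real r))"
        by (rule member_le_sum) (use rn in auto)
      also have "\<dots> \<le> C0"
        unfolding C0_def
        by (rule member_le_sum[of n "{..<N}" "\<lambda>n. \<Sum>r\<le>n. \<bar>err n r\<bar> * real n powr (1 / real r)"])
           (use 1 in \<open>auto intro!: sum_nonneg\<close>)
      also have "\<dots> \<le> C" by (simp add: C_def)
      finally have "\<bar>err n r\<bar> * real n powr (1 / real r) * ?u \<le> C * ?u" by (rule mult_right_mono) simp
      moreover have "real n powr (1 / real r) * ?u = 1" using n by (simp flip: powr_add)
      ultimately show ?thesis by (simp add: mult.assoc)
    next
      case 2
      have "\<bar>err n 1\<bar> \<le> 3 * (1 / real n)" using 2 by (intro N2) (simp add: N_def)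
      also have "\<dots> \<le> C * (1 / real n)"
      proof (rule mult_right_mono)
        have "1 \<le> exp (18 :: real)" by simp
        then show "3 \<le> C" using C0 unfolding C_def by linarith
      qed simp
      also have "1 / real n = ?u" using 2 n by (simp add: powr_minus_divide)
      finally show ?thesis using 2 by simp
    next
      case 3
      have "\<bar>err n r\<bar> \<le> 1000 * exp 18 * (?u + sqrt (real r / real n))"
        using 3 r by (intro N1) (simp_all add: N_def)
      also have "\<dots> \<le> 1000 * exp 18 * (?u + 2 * ?u)"
        using sqrt_ratio_le[OF 3(2) r(2) n] by (intro mult_left_mono add_left_mono) auto
      also have "\<dots> = 3000 * exp 18 * ?u" by simp
      also have "\<dots> \<le> C * ?u" using C0 by (intro mult_right_mono) (auto simp: C_def)
      finally show ?thesis .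
    qed
  qed
  have "C > 0" using C0 by (simp add: C_def add_nonneg_pos)
  moreover have "\<exists>\<epsilon>::real. \<bar>\<epsilon>\<bar> \<le> C * real n powr (- 1 / real r) \<and>
      nu n r = 1 / sqrt (2 * pi * real n * real r) *
        exp (- (real n * ln (real n) / real r) + real n / real r
             + (\<Sum>k=1..r. d_coeff r k * real n powr ((real r - real k) / real r)))
        * (1 + \<epsilon>)"
    if "n \<ge> 1" "1 \<le> r" "real r \<le> ln (real n)" for n r
  proof (intro exI conjI)
    show "\<bar>err n r\<bar> \<le> C * real n powr (- 1 / real r)" by (rule bound[OF that])
    have "nu n r = main_term n r * (1 + err n r)"
      using main_term_pos[OF that(1,2)] by (simp add: err_def)
    then show "nu n r = 1 / sqrt (2 * pi * real n * real r) *
        exp (- (real n * ln (real n) / real r) + real n / real r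
             + (\<Sum>k=1..r. d_coeff r k * real n powr ((real r - real k) / real r)))
        * (1 + err n r)"
      unfolding main_term_def .
  qed
  ultimately show ?thesis by blast
qed

end
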